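(* For sufficiently small constant $\varepsilon>0$ and all $n,k\in\mathbb N$ satisfying $k<n-2$, testing $k$-juntas under the uniform distribution on $\{0,1\}^n$ (with distance parameter $\varepsilon$) requires sample size at least $$\Omega\left(\sqrt{2^k\log\binom nk}+\log\binom nk\right).$$
   Context: A function $f:\{0,1\}^n\to\{0,1\}$ is a $k$-junta if there is a set of $k$ coordinates such that $f(x)$ depends only on the values of $x$ on these coordinates. $f$ is $\varepsilon$-far from being a $k$-junta under the uniform distribution if $\Pr_x[f(x)\ne g(x)]>\varepsilon$ for all $k$-juntas $g$, where $x$ is uniform in $\{0,1\}^n$. Testing $k$-juntas under the uniform distribution with distance parameter $\varepsilon$ and sample size $m$: the algorithm receives $m$ labelled examples $(x_i,f(x_i))$ of an unknown $f:\{0,1\}^n\to\{0,1\}$, with $x_i$ i.i.d. uniform in $\{0,1\}^n$; it must output Accept with probability $3/4$ if $f$ is a $k$-junta, and Reject with probability $3/4$ if $f$ is $\varepsilon$-far from being a $k$-junta under the uniform distribution. *)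

theory Defs
  imports "HOL-Probability.Probability"
begin

(* Points of {0,1}^n are Boolean lists of length n.  Functions on the cube are total functions
   on lists; every notion below looks only at their values on cube n. *)

definition cube :: "nat \<Rightarrow> bool list set" where
  "cube n = {x. length x = n}"

definition junta :: "nat \<Rightarrow> nat \<Rightarrow> (bool list \<Rightarrow> bool) \<Rightarrow> bool" where
  "junta n k f \<longleftrightarrow>
     (\<exists>S \<subseteq> {..<n}. card S = k \<and>
        (\<forall>x \<in> cube n. \<forall>y \<in> cube n. (\<forall>i \<in> S. x ! i = y ! i) \<longrightarrow> f x = f y))"

definition unif :: "nat \<Rightarrow> bool list pmf" where
  "unif n = pmf_of_set (cube n)"

definition far_from_juntas :: "nat \<Rightarrow> nat \<Rightarrow> real \<Rightarrow> (bool list \<Rightarrow> bool) \<Rightarrow> bool" where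
  "far_from_juntas n k \<epsilon> f \<longleftrightarrow>
     (\<forall>g. junta n k g \<longrightarrow> measure_pmf.prob (unif n) {x. f x \<noteq> g x} > \<epsilon>)"

datatype verdict = Accept | Reject

(* A randomized algorithm seeing only labelled examples.  Since there are just two verdicts,
   arbitrary internal randomness amounts to a verdict distribution for each labelled sample. *)
type_synonym tester = "(bool list \<times> bool) list \<Rightarrow> verdict pmf"

(* Verdict of A on m independent uniform examples labelled by f. *)
definition run_tester :: "tester \<Rightarrow> nat \<Rightarrow> nat \<Rightarrow> (bool list \<Rightarrow> bool) \<Rightarrow> verdict pmf" where
  "run_tester A n m f =
     bind_pmf (replicate_pmf m (unif n)) (\<lambda>xs. A (map (\<lambda>x. (x, f x)) xs))"

definition tests_juntas :: "tester \<Rightarrow> nat \<Rightarrow> nat \<Rightarrow> real \<Rightarrow> nat \<Rightarrow> bool" where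
  "tests_juntas A n k \<epsilon> m \<longleftrightarrow>
     (\<forall>f. (junta n k f \<longrightarrow> pmf (run_tester A n m f) Accept \<ge> 3 / 4) \<and>
          (far_from_juntas n k \<epsilon> f \<longrightarrow> pmf (run_tester A n m f) Reject \<ge> 3 / 4))"

end

theory Submission
  imports Defs
begin

text \<open>Juntas drawn from a prior \<open>\<nu>\<close> are compared with uniformly random functions, which are
  \<open>1/64\<close>-far from all \<open>k\<close>-juntas with probability at least \<open>3/4\<close> by counting. With labels \<open>\<plusminus>1\<close>
  and \<open>m\<close> samples, the second moment of the likelihood ratio is at most
  \<open>E (\<Prod>z\<in>cube n. 1 + m / 2 ^ n * f z * g z)\<close> for independent \<open>f, g\<close> drawn from \<open>\<nu>\<close>; if this is
  at most \<open>5/4\<close>, no tester works.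

  For parities on random \<open>k\<close>-sets, orthogonality bounds it by \<open>1 + exp m / (n choose k)\<close>, which
  yields the term \<open>log (n choose k)\<close>.

  If \<open>L = log (n choose k) \<le> 2 ^ k\<close>, take a uniformly random function of the coordinates in a
  random set \<open>S\<close>. The logarithm of the expectation for two fixed sets \<open>S, T\<close> is about
  \<open>m\<^sup>2 / 2 * (2 ^ (- card (S \<union> T)) - 2 ^ (- n))\<close>, the expected number of pairs of distinct points
  that collide both on \<open>S\<close> and on \<open>T\<close>. The set \<open>S\<close> (or its complement, when \<open>k > n / 2\<close>) picks one
  element from each of \<open>s\<close> blocks of size \<open>B\<close> with \<open>L = O(s log B)\<close>, so that \<open>card (S \<inter> T)\<close> is a
  binomial variable up to a constant, and its exponential moment stays bounded while
  \<open>m\<^sup>2 \<le> 2 ^ k * L / 10000\<close>.\<close>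

subsection \<open>Second moment of the likelihood ratio\<close>

definition sg :: "bool \<Rightarrow> real" where
  "sg b = (if b then 1 else - 1)"

lemma sg_simps [simp]: "sg True = 1" "sg False = - 1" "sg b * sg b = 1"
  by (auto simp: sg_def)

section \<open>Sums over all Boolean functions on a finite set\<close>

lemma sum_Pow_insert:
  fixes g :: "'a set \<Rightarrow> real"
  assumes "finite A" "x \<notin> A"
  shows "(\<Sum>H\<in>Pow (insert x A). g H) = (\<Sum>H\<in>Pow A. g H + g (insert x H))"
proof -
  have "(\<Sum>H\<in>Pow (insert x A). g H) = (\<Sum>H\<in>Pow A. g H) + (\<Sum>H\<in>insert x ` Pow A. g H)"
    unfolding Pow_insert by (rule sum.union_disjoint) (use assms in auto)
  also have "(\<Sum>H\<in>insert x ` Pow A. g H) = (\<Sum>H\<in>Pow A. g (insert x H))"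
    by (subst sum.reindex) (use assms in \<open>auto intro!: inj_onI simp: o_def\<close>)
  finally show ?thesis by (simp add: sum.distrib)
qed

text \<open>A set \<open>H\<close> encodes the Boolean function with support \<open>H\<close>. Its
  values at distinct points are chosen independently, so the sum over all functions factorises over
  the points.\<close>

lemma sum_Pow_prod:
  fixes a :: "'a \<Rightarrow> bool \<Rightarrow> real"
  assumes "finite C"
  shows "(\<Sum>H\<in>Pow C. \<Prod>z\<in>C. a z (z \<in> H)) = (\<Prod>z\<in>C. a z True + a z False)"
proof -
  have "(\<Prod>z\<in>C. a z (z \<in> H)) = (\<Prod>z\<in>H. a z True) * (\<Prod>z\<in>C-H. a z False)" if "H \<in> Pow C" for H
  proof -
    have "(\<Prod>z\<in>C. a z (z \<in> H)) = (\<Prod>z\<in>C-H. a z (z \<in> H)) * (\<Prod>z\<in>H. a z (z \<in> H))"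
      using that assms by (intro prod.subset_diff) auto
    then show ?thesis by (simp add: mult.commute)
  qed
  then show ?thesis using prod_add[OF assms, of "\<lambda>z. a z True" "\<lambda>z. a z False"] by simp
qed

lemma sum_Pow_prod_subset:
  fixes a :: "'a \<Rightarrow> bool \<Rightarrow> real"
  assumes "finite C" "X \<subseteq> C"
  shows "(\<Sum>H\<in>Pow C. \<Prod>z\<in>X. a z (z \<in> H)) = 2 ^ card C * (\<Prod>z\<in>X. (a z True + a z False) / 2)"
proof -
  define b where "b z v = (if z \<in> X then a z v else 1)" for z v
  have r: "(\<Prod>z\<in>C. if z \<in> X then h z else 1) = (\<Prod>z\<in>X. h z)" for h :: "'a \<Rightarrow> real"
    using assms by (simp add: prod.If_cases Int_absorb1)
  have "(\<Sum>H\<in>Pow C. \<Prod>z\<in>X. a z (z \<in> H)) = (\<Sum>H\<in>Pow C. \<Prod>z\<in>C. b z (z \<in> H))"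
    unfolding b_def by (subst r) simp
  also have "\<dots> = (\<Prod>z\<in>C. b z True + b z False)"
    by (rule sum_Pow_prod[OF assms(1)])
  also have "\<dots> = (\<Prod>z\<in>C. 2 * (if z \<in> X then (a z True + a z False) / 2 else 1))"
    by (rule prod.cong) (auto simp: b_def)
  also have "\<dots> = 2 ^ card C * (\<Prod>z\<in>X. (a z True + a z False) / 2)"
    by (simp add: prod.distrib r)
  finally show ?thesis .
qed

section \<open>Samples drawn with replacement\<close>

definition samples :: "'a set \<Rightarrow> nat \<Rightarrow> 'a list set" where
  "samples C m = {xs. set xs \<subseteq> C \<and> length xs = m}"

lemma finite_samples [simp]: "finite C \<Longrightarrow> finite (samples C m)"
  unfolding samples_def by (rule finite_lists_length_eq)

lemma card_samples: "finite C \<Longrightarrow> card (samples C m) = card C ^ m"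
  unfolding samples_def by (rule card_lists_length_eq)

lemma samples_0 [simp]: "samples C 0 = {[]}"
  by (auto simp: samples_def)

lemma samples_Suc: "samples C (Suc m) = (\<lambda>(x, xs). x # xs) ` (C \<times> samples C m)"
  by (auto simp: samples_def length_Suc_conv image_iff)

lemma sum_samples_Suc:
  "(\<Sum>xs\<in>samples C (Suc m). g xs) = (\<Sum>x\<in>C. \<Sum>xs\<in>samples C m. g (x # xs))"
  unfolding samples_Suc sum.cartesian_product
  by (subst sum.reindex) (auto intro!: inj_onI sum.cong)

text \<open>A union bound: there are at most m^a assignments of the a points of \<open>A\<close> to
  draws, each realised with probability N^-a, where N = \<open>card C\<close>. The induction on
  \<open>m\<close> conditions on the first draw, which either misses \<open>A\<close> or removes one
  point from it.\<close>

lemma hitting_samples: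
  assumes "finite C" "C \<noteq> {}" "A \<subseteq> C"
  shows "(\<Sum>xs\<in>samples C m. of_bool (A \<subseteq> set xs)) \<le> (real m / card C) ^ card A * real (card C) ^ m"
  using assms(3)
proof (induction m arbitrary: A)
  case 0
  then show ?case using assms finite_subset[OF 0 assms(1)] by (auto simp: power_0_left)
next
  case (Suc m)
  let ?N = "real (card C)"
  let ?a = "card A"
  have N: "?N > 0" using assms by (simp add: card_gt_0_iff)
  have fA: "finite A" using Suc.prems assms finite_subset by auto
  have "(\<Sum>xs\<in>samples C (Suc m). of_bool (A \<subseteq> set xs)) =
      (\<Sum>x\<in>C. \<Sum>xs\<in>samples C m. of_bool (A - {x} \<subseteq> set xs) :: real)"
    unfolding sum_samples_Suc by (intro sum.cong refl arg_cong[of _ _ of_bool]) auto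
  also have "\<dots> \<le> (\<Sum>x\<in>C. (real m / ?N) ^ ?a * ?N ^ m +
      of_bool (x \<in> A) * ((real m / ?N) ^ (?a - 1) * ?N ^ m))"
  proof (rule sum_mono)
    fix x assume "x \<in> C"
    show "(\<Sum>xs\<in>samples C m. of_bool (A - {x} \<subseteq> set xs)) \<le> (real m / ?N) ^ ?a * ?N ^ m +
      of_bool (x \<in> A) * ((real m / ?N) ^ (?a - 1) * ?N ^ m)"
    proof (cases "x \<in> A")
      case True
      have "(\<Sum>xs\<in>samples C m. of_bool (A - {x} \<subseteq> set xs)) \<le> (real m / ?N) ^ (?a - 1) * ?N ^ m"
        using Suc.IH[of "A - {x}"] Suc.prems True fA by (auto simp: card_Diff_singleton)
      moreover have "0 \<le> (real m / ?N) ^ ?a * ?N ^ m" by simp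
      ultimately show ?thesis using True by (simp only: of_bool_eq mult_1)
    next
      case False
      then show ?thesis using Suc.IH[of A] Suc.prems by simp
    qed
  qed
  also have "\<dots> = ?N * ((real m / ?N) ^ ?a * ?N ^ m) + ?a * ((real m / ?N) ^ (?a - 1) * ?N ^ m)"
    using Suc.prems assms(1) by (simp add: sum.distrib flip: sum_distrib_right) (simp add: of_bool_def sum.If_cases Int_absorb1)
  also have "\<dots> = ((real m / ?N) ^ ?a + ?a * (1 / ?N) * (real m / ?N) ^ (?a - 1)) * ?N ^ Suc m"
    using N by (simp add: field_simps)
  also have "\<dots> \<le> (real (Suc m) / ?N) ^ ?a * ?N ^ Suc m"
  proof (rule mult_right_mono)
    \<comment> \<open>The first two terms of the binomial expansion. With x = m/N and y = 1/N they
      bound the cases where the first draw misses or hits \<open>A\<close>.\<close>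
    have b: "x ^ a + a * y * x ^ (a - 1) \<le> (x + y) ^ a" if "0 \<le> x" "0 \<le> y" for x y :: real and a :: nat
    proof (induction a)
      case (Suc a)
      show ?case
      proof (cases a)
        case [simp]: (Suc b)
        have "x ^ Suc a + Suc a * y * x ^ (Suc a - 1) \<le> (x + y) * (x ^ a + a * y * x ^ (a - 1))"
          using that by (simp add: algebra_simps)
        also have "\<dots> \<le> (x + y) * (x + y) ^ a"
          using Suc.IH that by (intro mult_left_mono) auto
        finally show ?thesis by simp
      qed auto
    qed auto
    show "(real m / ?N) ^ ?a + ?a * (1 / ?N) * (real m / ?N) ^ (?a - 1) \<le> (real (Suc m) / ?N) ^ ?a"
      using b[of "real m / ?N" "1 / ?N" ?a] N by (simp add: add_divide_distrib add.commute)
  qed simp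
  finally show ?case .
qed

text \<open>The coefficients \<open>(\<Sum>w. \<Prod>z\<in>A. u w z)\<^sup>2\<close> of the expansion are nonnegative, which
  allows replacing the probability that a sample hits all of \<open>A\<close> by its upper bound.\<close>

lemma sample_second_moment:
  fixes u :: "'w \<Rightarrow> 'a \<Rightarrow> real"
  assumes "finite C" "C \<noteq> {}"
  shows "(\<Sum>xs\<in>samples C m. \<Sum>w\<in>W. \<Sum>w'\<in>W. \<Prod>z\<in>set xs. 1 + u w z * u w' z)
    \<le> real (card C) ^ m * (\<Sum>w\<in>W. \<Sum>w'\<in>W. \<Prod>z\<in>C. 1 + real m / card C * (u w z * u w' z))"
proof -
  define c where "c A = (\<Sum>w\<in>W. \<Prod>z\<in>A. u w z)\<^sup>2" for A
  have c: "(\<Sum>w\<in>W. \<Sum>w'\<in>W. \<Prod>z\<in>A. u w z * u w' z) = c A" for A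
    by (simp add: c_def power2_eq_square sum_product prod.distrib)
  \<comment> \<open>One expansion serves both sides: weight p = 1 over the points seen in a sample,
    weight p = m/N over all of \<open>C\<close>.\<close>
  have expand: "(\<Sum>w\<in>W. \<Sum>w'\<in>W. \<Prod>z\<in>X. 1 + p * (u w z * u w' z)) =
      (\<Sum>A\<in>Pow X. p ^ card A * c A)" if "finite X" for X and p :: real
  proof -
    have "(\<Prod>z\<in>X. 1 + p * (u w z * u w' z)) = (\<Sum>A\<in>Pow X. p ^ card A * (\<Prod>z\<in>A. u w z * u w' z))" for w w'
      using prod_add[OF that, of "\<lambda>z. p * (u w z * u w' z)" "\<lambda>_. 1"] by (simp add: add.commute prod.distrib)
    then have "(\<Sum>w\<in>W. \<Sum>w'\<in>W. \<Prod>z\<in>X. 1 + p * (u w z * u w' z)) =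
      (\<Sum>w\<in>W. \<Sum>w'\<in>W. \<Sum>A\<in>Pow X. p ^ card A * (\<Prod>z\<in>A. u w z * u w' z))" by simp
    also have "\<dots> = (\<Sum>A\<in>Pow X. \<Sum>w\<in>W. \<Sum>w'\<in>W. p ^ card A * (\<Prod>z\<in>A. u w z * u w' z))"
      by (simp add: sum.swap[of _ "Pow X"])
    finally show ?thesis by (simp add: c flip: sum_distrib_left)
  qed
  have "(\<Sum>xs\<in>samples C m. \<Sum>w\<in>W. \<Sum>w'\<in>W. \<Prod>z\<in>set xs. 1 + u w z * u w' z) =
     (\<Sum>xs\<in>samples C m. \<Sum>A\<in>Pow (set xs). c A)"
    using expand[of "set _" 1] by simp
  also have "\<dots> = (\<Sum>xs\<in>samples C m. \<Sum>A\<in>Pow C. of_bool (A \<subseteq> set xs) * c A)"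
  proof (rule sum.cong[OF refl])
    fix xs assume "xs \<in> samples C m"
    then have "Pow C \<inter> {A. A \<subseteq> set xs} = Pow (set xs)" by (auto simp: samples_def)
    then show "(\<Sum>A\<in>Pow (set xs). c A) = (\<Sum>A\<in>Pow C. of_bool (A \<subseteq> set xs) * c A)"
      using assms(1) by (simp add: of_bool_def if_distrib[of "\<lambda>x. x * _"] sum.If_cases cong: if_cong)
  qed
  also have "\<dots> = (\<Sum>A\<in>Pow C. (\<Sum>xs\<in>samples C m. of_bool (A \<subseteq> set xs)) * c A)"
    by (subst sum.swap) (simp add: sum_distrib_right)
  also have "\<dots> \<le> (\<Sum>A\<in>Pow C. ((real m / card C) ^ card A * real (card C) ^ m) * c A)"
    by (intro sum_mono mult_right_mono hitting_samples assms) (auto simp: c_def)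
  also have "\<dots> = real (card C) ^ m * (\<Sum>A\<in>Pow C. (real m / card C) ^ card A * c A)"
    by (simp add: sum_distrib_left mult_ac)
  finally show ?thesis unfolding expand[OF assms(1)] .
qed

text \<open>A change of measure. The product is zero unless \<open>H\<close> agrees with
  \<open>f\<close> on the sample, and then it is 2 to the number of distinct sample points, the
  inverse of the probability of agreement. Hence it is the likelihood ratio of the labels under
  \<open>f\<close> against uniformly random labels.\<close>

lemma agreement_sum:
  assumes "finite C" "set xs \<subseteq> C"
  shows "(\<Sum>H\<in>Pow C. (\<Prod>z\<in>set xs. 1 + sg (z \<in> H) * sg (f z)) * q (map (\<lambda>z. (z, z \<in> H)) xs))
    = 2 ^ card C * q (map (\<lambda>z. (z, f z)) xs)"
proof -
  have "(\<Prod>z\<in>set xs. 1 + sg (z \<in> H) * sg (f z)) * q (map (\<lambda>z. (z, z \<in> H)) xs)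
    = (\<Prod>z\<in>set xs. 1 + sg (z \<in> H) * sg (f z)) * q (map (\<lambda>z. (z, f z)) xs)" for H
  proof (cases "\<forall>z\<in>set xs. (z \<in> H) = f z")
    case True
    then have "map (\<lambda>z. (z, z \<in> H)) xs = map (\<lambda>z. (z, f z)) xs" by simp
    then show ?thesis by (simp only:)
  next
    case False
    then have "(\<Prod>z\<in>set xs. 1 + sg (z \<in> H) * sg (f z)) = 0" by (auto simp: sg_def)
    then show ?thesis by simp
  qed
  then have "(\<Sum>H\<in>Pow C. (\<Prod>z\<in>set xs. 1 + sg (z \<in> H) * sg (f z)) * q (map (\<lambda>z. (z, z \<in> H)) xs))
    = (\<Sum>H\<in>Pow C. \<Prod>z\<in>set xs. 1 + sg (z \<in> H) * sg (f z)) * q (map (\<lambda>z. (z, f z)) xs)"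
    by (simp only: sum_distrib_right)
  then show ?thesis
    using sum_Pow_prod_subset[OF assms, of "\<lambda>z b. 1 + sg b * sg (f z)"] by simp
qed

text \<open>Averaging over the label at one point leaves ((1 + a)(1 + b) + (1 - a)(1 - b)) / 2 = 1 +
  a b, and the points are independent.\<close>

lemma agreement_product_sum:
  assumes "finite C" "X \<subseteq> C"
  shows "(\<Sum>H\<in>Pow C. (\<Prod>z\<in>X. 1 + sg (z \<in> H) * sg (f z)) * (\<Prod>z\<in>X. 1 + sg (z \<in> H) * sg (g z)))
    = 2 ^ card C * (\<Prod>z\<in>X. 1 + sg (f z) * sg (g z))"
proof -
  have "((1 + sg True * sg a) * (1 + sg True * sg b) + (1 + sg False * sg a) * (1 + sg False * sg b)) / 2
     = 1 + sg a * sg b" for a b by (simp add: algebra_simps)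
  then show ?thesis
    using sum_Pow_prod_subset[OF assms, of "\<lambda>z b. (1 + sg b * sg (f z)) * (1 + sg b * sg (g z))"]
    by (simp only: prod.distrib)
qed

text \<open>With \<open>r\<close> a likelihood ratio and \<open>q\<close> an acceptance probability, this turns a bound on the second
  moment of \<open>r\<close> into a bound on the advantage, in place of the Cauchy-Schwarz inequality.\<close>

lemma second_moment_linearization:
  fixes r q :: real
  assumes "0 \<le> q" "q \<le> 1"
  shows "r * q \<le> q + r\<^sup>2 / 2 - r / 2 + 1 / 8"
proof -
  \<comment> \<open>This says |r - 1| \<le> (r - 1)^2 + 1/4. Centring \<open>q\<close> at 1/2 bounds
    its factor by 1/2; the remaining part (r - 1)/2 averages to zero when \<open>r\<close> has mean
    1.\<close>
  have "0 \<le> (\<bar>r - 1\<bar> - 1 / 2)\<^sup>2" by simp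
  also have "\<dots> = r\<^sup>2 - 2 * r - \<bar>r - 1\<bar> + 5 / 4"
    unfolding power2_diff by (simp add: power2_diff power_divide)
  finally have "\<bar>r - 1\<bar> \<le> r\<^sup>2 - 2 * r + 5 / 4" by simp
  moreover have "\<bar>(r - 1) * (q - 1 / 2)\<bar> \<le> \<bar>r - 1\<bar> * (1 / 2)"
    unfolding abs_mult using assms by (intro mult_left_mono) (auto simp: abs_if)
  then have "(r - 1) * (q - 1 / 2) \<le> \<bar>r - 1\<bar> * (1 / 2)"
    by (rule abs_le_D1)
  ultimately have "(r - 1) * (q - 1 / 2) \<le> (r\<^sup>2 - 2 * r + 5 / 4) * (1 / 2)"
    by (meson mult_right_mono order_trans zero_le_divide_1_iff zero_le_numeral)
  then show ?thesis by (simp add: field_simps)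
qed

text \<open>The likelihood ratio of the mixture over \<open>W\<close> has mean 1 and second moment
  at most 5/4, so the linearised bound leaves an excess of at most 5/8 - 1/2 + 1/8 = 1/4.\<close>

lemma average_acceptance_gap:
  fixes F :: "'w \<Rightarrow> 'a \<Rightarrow> bool" and q :: "('a \<times> bool) list \<Rightarrow> real"
  assumes C: "finite C" "C \<noteq> {}" and W: "finite W" "W \<noteq> {}"
    and q: "\<And>ys. 0 \<le> q ys" "\<And>ys. q ys \<le> 1"
    and overlap: "(\<Sum>w\<in>W. \<Sum>w'\<in>W. \<Prod>z\<in>C. 1 + real m / card C * (sg (F w z) * sg (F w' z)))
      \<le> 5 / 4 * (real (card W))\<^sup>2"
  shows "(\<Sum>w\<in>W. \<Sum>xs\<in>samples C m. q (map (\<lambda>z. (z, F w z)) xs)) / (real (card W) * real (card C) ^ m)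
    \<le> (\<Sum>H\<in>Pow C. \<Sum>xs\<in>samples C m. q (map (\<lambda>z. (z, z \<in> H)) xs)) / (2 ^ card C * real (card C) ^ m) + 1 / 4"
proof -
  let ?M = "real (card C) ^ m" and ?P = "2 ^ card C :: real" and ?w = "real (card W)"
  have pos: "?M > 0" "?P > 0" "?w > 0" using C W by (auto simp: card_gt_0_iff)
  define r where "r w xs H = (\<Prod>z\<in>set xs. 1 + sg (z \<in> H) * sg (F w z))" for w xs H
  define R where "R xs H = (\<Sum>w\<in>W. r w xs H) / ?w" for xs H
  define Q where "Q xs H = q (map (\<lambda>z. (z, z \<in> H)) xs)" for xs H
  have sub: "set xs \<subseteq> C" if "xs \<in> samples C m" for xs using that by (simp add: samples_def)
  \<comment> \<open>Change of measure for the mixture. The constant function 1 gives the first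
    moment of \<open>R\<close>, and \<open>q\<close> gives the acceptance probability under the
    prior.\<close>
  have mean: "(\<Sum>H\<in>Pow C. R xs H * g (map (\<lambda>z. (z, z \<in> H)) xs)) =
      ?P * (\<Sum>w\<in>W. g (map (\<lambda>z. (z, F w z)) xs)) / ?w" if "xs \<in> samples C m" for xs g
  proof -
    have "(\<Sum>H\<in>Pow C. R xs H * g (map (\<lambda>z. (z, z \<in> H)) xs)) =
      (\<Sum>w\<in>W. \<Sum>H\<in>Pow C. r w xs H * g (map (\<lambda>z. (z, z \<in> H)) xs)) / ?w"
      unfolding R_def by (subst sum.swap) (simp add: sum_distrib_right sum_divide_distrib)
    also have "\<dots> = (\<Sum>w\<in>W. ?P * g (map (\<lambda>z. (z, F w z)) xs)) / ?w"
      unfolding r_def using agreement_sum[OF C(1) sub[OF that]] by simp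
    finally show ?thesis by (simp add: sum_distrib_left)
  qed
  have one: "(\<Sum>H\<in>Pow C. R xs H) = ?P" if "xs \<in> samples C m" for xs
    using mean[OF that, of "\<lambda>_. 1"] pos by simp
  have "(\<Sum>xs\<in>samples C m. \<Sum>H\<in>Pow C. (R xs H)\<^sup>2) =
      (\<Sum>xs\<in>samples C m. \<Sum>w\<in>W. \<Sum>w'\<in>W. \<Sum>H\<in>Pow C. r w xs H * r w' xs H) / ?w\<^sup>2"
    by (simp add: R_def power2_eq_square sum_product sum_divide_distrib sum.swap[of _ "Pow C"])
  also have "\<dots> = (\<Sum>xs\<in>samples C m. \<Sum>w\<in>W. \<Sum>w'\<in>W. ?P * (\<Prod>z\<in>set xs. 1 + sg (F w z) * sg (F w' z))) / ?w\<^sup>2"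
    unfolding r_def by (simp add: agreement_product_sum[OF C(1) sub])
  also have "\<dots> = ?P * (\<Sum>xs\<in>samples C m. \<Sum>w\<in>W. \<Sum>w'\<in>W. \<Prod>z\<in>set xs. 1 + sg (F w z) * sg (F w' z)) / ?w\<^sup>2"
    by (simp add: sum_distrib_left)
  also have "\<dots> \<le> ?P * (?M * (5 / 4 * ?w\<^sup>2)) / ?w\<^sup>2"
    using overlap
    by (intro divide_right_mono mult_left_mono order_trans[OF sample_second_moment[OF C]]) auto
  finally have second: "(\<Sum>xs\<in>samples C m. \<Sum>H\<in>Pow C. (R xs H)\<^sup>2) \<le> 5 / 4 * (?P * ?M)"
    using pos by simp
  have cs: "(\<Sum>xs\<in>samples C m. \<Sum>H\<in>Pow C. 1) = ?P * ?M"
    using C by (simp add: card_samples card_Pow)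
  have first: "(\<Sum>xs\<in>samples C m. \<Sum>H\<in>Pow C. R xs H) = ?P * ?M"
    using one C by (simp add: card_samples)
  have "(\<Sum>w\<in>W. \<Sum>xs\<in>samples C m. q (map (\<lambda>z. (z, F w z)) xs)) * ?P / ?w =
      (\<Sum>xs\<in>samples C m. \<Sum>H\<in>Pow C. R xs H * Q xs H)"
    unfolding Q_def by (simp add: mean sum_distrib_left sum_distrib_right sum_divide_distrib mult_ac)
      (rule sum.swap)
  also have "\<dots> \<le> (\<Sum>xs\<in>samples C m. \<Sum>H\<in>Pow C. Q xs H + (R xs H)\<^sup>2 / 2 - R xs H / 2 + 1 / 8)"
  proof (intro sum_mono)
    fix xs H
    have "0 \<le> Q xs H" "Q xs H \<le> 1" using q by (auto simp: Q_def)
    then show "R xs H * Q xs H \<le> Q xs H + (R xs H)\<^sup>2 / 2 - R xs H / 2 + 1 / 8"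
      by (rule second_moment_linearization)
  qed
  also have "\<dots> = (\<Sum>xs\<in>samples C m. \<Sum>H\<in>Pow C. Q xs H) + (\<Sum>xs\<in>samples C m. \<Sum>H\<in>Pow C. (R xs H)\<^sup>2) / 2
      - ?P * ?M / 2 + ?P * ?M / 8"
  proof -
    have "(\<Sum>xs\<in>samples C m. \<Sum>H\<in>Pow C. 1 / 8 :: real) = ?P * ?M / 8"
      "(\<Sum>xs\<in>samples C m. \<Sum>H\<in>Pow C. R xs H / 2) = ?P * ?M / 2"
      using cs first by (simp_all only: flip: sum_divide_distrib)
    then show ?thesis
      by (simp only: sum.distrib sum_subtractf) (simp add: sum_divide_distrib)
  qed
  also have "\<dots> \<le> (\<Sum>xs\<in>samples C m. \<Sum>H\<in>Pow C. Q xs H) + ?P * ?M / 4"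
    using second by linarith
  also have "(\<Sum>xs\<in>samples C m. \<Sum>H\<in>Pow C. Q xs H) = (\<Sum>H\<in>Pow C. \<Sum>xs\<in>samples C m. Q xs H)"
    by (rule sum.swap)
  finally show ?thesis using pos C(2) by (auto simp: field_simps Q_def card_gt_0_iff)
qed

section \<open>The cube and the verdict of a tester\<close>

lemma finite_cube [simp]: "finite (cube n)"
  and card_cube: "card (cube n) = 2 ^ n"
  using finite_lists_length_eq[of "UNIV :: bool set" n] card_lists_length_eq[of "UNIV :: bool set" n]
  by (simp_all add: cube_def card_UNIV_bool)

lemma cube_nonempty [simp]: "cube n \<noteq> {}"
  using card_cube[of n] by (metis card.empty power_not_zero zero_neq_numeral)

lemma replicate_pmf_of_set:
  assumes "finite C" "C \<noteq> {}"
  shows "replicate_pmf m (pmf_of_set C) = pmf_of_set (samples C m)"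
proof (induction m)
  case (Suc m)
  have ne: "samples C m \<noteq> {}"
    using card_samples[OF assms(1), of m] assms by (metis card.empty card_0_eq power_not_zero)
  have "replicate_pmf (Suc m) (pmf_of_set C) =
      map_pmf (\<lambda>(x, xs). x # xs) (pair_pmf (pmf_of_set C) (pmf_of_set (samples C m)))"
    by (simp add: Suc pair_pmf_def map_bind_pmf map_pmf_def bind_assoc_pmf bind_return_pmf)
  also have "pair_pmf (pmf_of_set C) (pmf_of_set (samples C m)) = pmf_of_set (C \<times> samples C m)"
  proof (rule pmf_eqI)
    fix z :: "'a \<times> 'a list"
    show "pmf (pair_pmf (pmf_of_set C) (pmf_of_set (samples C m))) z = pmf (pmf_of_set (C \<times> samples C m)) z"
      using assms ne by (cases z) (simp add: pmf_pair indicator_def card_cartesian_product)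
  qed
  also have "map_pmf (\<lambda>(x, xs). x # xs) (pmf_of_set (C \<times> samples C m)) =
      pmf_of_set ((\<lambda>(x, xs). x # xs) ` (C \<times> samples C m))"
    using assms ne by (intro map_pmf_of_set_inj) (auto intro!: inj_onI)
  finally show ?case by (simp add: samples_Suc)
qed (simp add: pmf_of_set_singleton)

lemma pmf_run_tester:
  "pmf (run_tester A n m f) v =
    (\<Sum>xs\<in>samples (cube n) m. pmf (A (map (\<lambda>x. (x, f x)) xs)) v) / real (card (cube n)) ^ m"
proof -
  have "samples (cube n) m \<noteq> {}"
    using card_samples[OF finite_cube, of n m] by (metis card.empty card_cube power_not_zero zero_neq_numeral)
  then show ?thesis
    unfolding run_tester_def unif_def replicate_pmf_of_set[OF finite_cube cube_nonempty]
    by (simp add: pmf_bind integral_pmf_of_set card_samples)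
qed

lemma pmf_Accept_Reject: "pmf p Accept + pmf p Reject = 1"
proof -
  have "(\<Sum>v\<in>{Accept, Reject}. pmf p v) = 1"
    by (rule sum_pmf_eq_1) (use verdict.exhaust in auto)
  then show ?thesis by simp
qed

text \<open>Juntas are accepted with probability at least 3/4, a uniformly random function with
  probability at most 1 - 3/4 * 3/4 = 7/16. The gap 5/16 exceeds the 1/4 that a second moment of at
  most 5/4 would allow.\<close>

lemma tests_juntas_overlap:
  fixes F :: "'w \<Rightarrow> bool list \<Rightarrow> bool"
  assumes tests: "tests_juntas A n k \<epsilon> m"
    and W: "finite W" "W \<noteq> {}" and junta: "\<And>w. w \<in> W \<Longrightarrow> junta n k (F w)"
    and far: "3 / 4 * 2 ^ 2 ^ n \<le> real (card {H \<in> Pow (cube n). far_from_juntas n k \<epsilon> (\<lambda>z. z \<in> H)})"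
  shows "5 / 4 * (real (card W))\<^sup>2 <
    (\<Sum>w\<in>W. \<Sum>w'\<in>W. \<Prod>z\<in>cube n. 1 + real m / 2 ^ n * (sg (F w z) * sg (F w' z)))"
proof (rule ccontr)
  assume neg: "\<not> ?thesis"
  let ?acc = "\<lambda>f. pmf (run_tester A n m f) Accept"
  let ?M = "real (card (cube n)) ^ m"
  have pos: "?M > 0" "real (card W) > 0" using W by (auto simp: card_gt_0_iff)
  have acc: "(\<Sum>xs\<in>samples (cube n) m. pmf (A (map (\<lambda>x. (x, f x)) xs)) Accept) = ?M * ?acc f" for f
    using pos by (simp add: pmf_run_tester)
  have "(\<Sum>w\<in>W. \<Sum>xs\<in>samples (cube n) m. pmf (A (map (\<lambda>z. (z, F w z)) xs)) Accept) / (card W * ?M)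
    \<le> (\<Sum>H\<in>Pow (cube n). \<Sum>xs\<in>samples (cube n) m. pmf (A (map (\<lambda>z. (z, z \<in> H)) xs)) Accept)
        / (2 ^ card (cube n) * ?M) + 1 / 4"
    using neg W by (intro average_acceptance_gap[where q = "\<lambda>ys. pmf (A ys) Accept"]) (auto simp: pmf_le_1 card_cube)
  then have gap: "(\<Sum>w\<in>W. ?acc (F w)) / card W \<le> (\<Sum>H\<in>Pow (cube n). ?acc (\<lambda>z. z \<in> H)) / 2 ^ 2 ^ n + 1 / 4"
    unfolding acc using pos by (simp add: card_cube flip: sum_distrib_left)
  have "(\<Sum>w\<in>W. 3 / 4) \<le> (\<Sum>w\<in>W. ?acc (F w))"
    using tests junta by (intro sum_mono) (auto simp: tests_juntas_def)
  then have yes: "3 / 4 \<le> (\<Sum>w\<in>W. ?acc (F w)) / card W"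
    using pos by (simp add: field_simps)
  let ?far = "\<lambda>H. far_from_juntas n k \<epsilon> (\<lambda>z. z \<in> H)"
  have "(\<Sum>H\<in>Pow (cube n). ?acc (\<lambda>z. z \<in> H)) \<le> (\<Sum>H\<in>Pow (cube n). 1 - 3 / 4 * of_bool (?far H))"
  proof (rule sum_mono)
    fix H
    show "?acc (\<lambda>z. z \<in> H) \<le> 1 - 3 / 4 * of_bool (?far H)"
      using tests pmf_Accept_Reject[of "run_tester A n m (\<lambda>z. z \<in> H)"]
        pmf_le_1[of "run_tester A n m (\<lambda>z. z \<in> H)" Accept]
      by (cases "?far H") (fastforce simp: tests_juntas_def)+
  qed
  also have "\<dots> = 2 ^ 2 ^ n - 3 / 4 * real (card {H \<in> Pow (cube n). ?far H})"
  proof -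
    have "(\<Sum>H\<in>Pow (cube n). of_bool (?far H)) = real (card {H \<in> Pow (cube n). ?far H})"
      by (simp add: of_bool_def sum.If_cases Int_def)
    then show ?thesis
      by (simp only: sum_subtractf flip: sum_distrib_left) (simp add: card_Pow card_cube)
  qed
  also have "\<dots> \<le> 2 ^ 2 ^ n * (7 / 16)"
    using far by simp
  finally have "(\<Sum>H\<in>Pow (cube n). ?acc (\<lambda>z. z \<in> H)) / 2 ^ 2 ^ n \<le> 7 / 16"
    by (simp add: field_simps)
  with yes gap show False by simp
qed

subsection \<open>Uniformly random functions\<close>

text \<open>Restrictions of points to \<open>S\<close> are encoded as subsets of \<open>S\<close>. A
  function of the coordinates in \<open>S\<close> then becomes a family in
  \<open>Pow (Pow S)\<close>, so a random junta on \<open>S\<close> is a uniform element of a finite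
  set.\<close>

definition ones_on :: "nat set \<Rightarrow> bool list \<Rightarrow> nat set" where
  "ones_on S x = {i \<in> S. x ! i}"

lemma junta_iff_ones_on:
  "junta n k g \<longleftrightarrow>
    (\<exists>S \<phi>. S \<subseteq> {..<n} \<and> card S = k \<and> \<phi> \<subseteq> Pow S \<and> (\<forall>x\<in>cube n. g x \<longleftrightarrow> ones_on S x \<in> \<phi>))"
proof
  assume "junta n k g"
  then obtain S where S: "S \<subseteq> {..<n}" "card S = k"
    and dep: "\<And>x y. \<lbrakk>x \<in> cube n; y \<in> cube n; \<forall>i\<in>S. x ! i = y ! i\<rbrakk> \<Longrightarrow> g x = g y"
    unfolding junta_def by blast
  have "g x = g y" if "x \<in> cube n" "y \<in> cube n" "ones_on S x = ones_on S y" for x y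
    using dep[OF that(1,2)] that(3) by (auto simp: ones_on_def)
  then have "\<forall>x\<in>cube n. g x \<longleftrightarrow> ones_on S x \<in> ones_on S ` {y \<in> cube n. g y}"
    by blast
  moreover have "ones_on S ` {y \<in> cube n. g y} \<subseteq> Pow S" by (auto simp: ones_on_def)
  ultimately show "\<exists>S \<phi>. S \<subseteq> {..<n} \<and> card S = k \<and> \<phi> \<subseteq> Pow S \<and> (\<forall>x\<in>cube n. g x \<longleftrightarrow> ones_on S x \<in> \<phi>)"
    using S by blast
next
  assume "\<exists>S \<phi>. S \<subseteq> {..<n} \<and> card S = k \<and> \<phi> \<subseteq> Pow S \<and> (\<forall>x\<in>cube n. g x \<longleftrightarrow> ones_on S x \<in> \<phi>)"
  then obtain S \<phi> where S: "S \<subseteq> {..<n}" "card S = k" and g: "\<forall>x\<in>cube n. g x \<longleftrightarrow> ones_on S x \<in> \<phi>"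
    by blast
  have "g x = g y" if "x \<in> cube n" "y \<in> cube n" "\<forall>i\<in>S. x ! i = y ! i" for x y
  proof -
    have "ones_on S x = ones_on S y" using that by (auto simp: ones_on_def)
    then show ?thesis using g that by simp
  qed
  then show "junta n k g" unfolding junta_def using S by blast
qed

text \<open>A Chernoff bound: the weight 16^(N/64 - card D) is at least 1 on the counted sets, and
  its sum over all \<open>D\<close> is 16^(N/64) (17/16)^N with N = \<open>card C\<close>.\<close>

lemma small_subsets_card:
  assumes "finite C"
  shows "real (card {D \<in> Pow C. card D \<le> card C / 64}) \<le> 2 powr (3 / 16 * card C)"
proof -
  let ?N = "real (card C)"
  have "real (card {D \<in> Pow C. card D \<le> ?N / 64}) \<le> (\<Sum>D\<in>Pow C. 16 powr (?N / 64) * (1 / 16) ^ card D)"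
  proof -
    have "real (card {D \<in> Pow C. card D \<le> ?N / 64}) = (\<Sum>D\<in>{D \<in> Pow C. card D \<le> ?N / 64}. 1)" by simp
    also have "\<dots> \<le> (\<Sum>D\<in>{D \<in> Pow C. card D \<le> ?N / 64}. 16 powr (?N / 64) * (1 / 16) ^ card D)"
    proof (rule sum_mono)
      fix D assume "D \<in> {D \<in> Pow C. card D \<le> ?N / 64}"
      then have "16 powr real (card D) \<le> 16 powr (?N / 64)" by (intro powr_mono) auto
      then show "1 \<le> 16 powr (?N / 64) * (1 / 16) ^ card D"
        by (simp add: powr_realpow power_divide field_simps)
    qed
    also have "\<dots> \<le> (\<Sum>D\<in>Pow C. 16 powr (?N / 64) * (1 / 16) ^ card D)"
      by (rule sum_mono2) (use assms in auto)
    finally show ?thesis .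
  qed
  also have "\<dots> = 16 powr (?N / 64) * (17 / 16) ^ card C"
    using prod_add[OF assms, of "\<lambda>_. 1 / 16 :: real" "\<lambda>_. 1"] by (simp flip: sum_distrib_left)
  also have "\<dots> \<le> 2 powr (?N / 16) * 2 powr (?N / 8)"
  proof (rule mult_mono)
    have "(16::real) powr (?N / 64) = (2 powr 4) powr (?N / 64)" by simp
    also have "\<dots> = 2 powr (?N / 16)" by (simp only: powr_powr) simp
    finally show "(16::real) powr (?N / 64) \<le> 2 powr (?N / 16)" by simp
    have "(17 / 16 :: real) \<le> 2 powr (1 / 8)"
    proof (rule power_le_imp_le_base)
      show "(17 / 16 :: real) ^ Suc 7 \<le> (2 powr (1 / 8)) ^ Suc 7"
        by (simp add: powr_power power_divide)
    qed simp
    then have "(17 / 16 :: real) ^ card C \<le> (2 powr (1 / 8)) ^ card C" by (intro power_mono) auto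
    then show "(17 / 16 :: real) ^ card C \<le> 2 powr (?N / 8)" by (simp add: powr_power)
  qed auto
  finally show ?thesis by (simp flip: powr_add)
qed

text \<open>A function that is not far is the exclusive or of a junta and a small disagreement set
  \<open>D\<close>, as expressed by \<open>code\<close>. The choices of \<open>S\<close>,
  \<open>\<phi>\<close> and \<open>D\<close> contribute at most N/4, N/8 and 3N/16 to the binary
  logarithm of the count, where N = 2^n; the total 9N/16 is at most N - 2 because N \<ge>
  16.\<close>

lemma most_functions_far:
  assumes n: "k + 2 < n" "4 \<le> n" and \<epsilon>: "\<epsilon> \<le> 1 / 64"
  shows "3 / 4 * 2 ^ 2 ^ n \<le> real (card {H \<in> Pow (cube n). far_from_juntas n k \<epsilon> (\<lambda>z. z \<in> H)})"
proof -
  let ?far = "\<lambda>H. far_from_juntas n k \<epsilon> (\<lambda>z. z \<in> H)"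
  define N :: real where "N = 2 ^ n"
  define near where "near = {H \<in> Pow (cube n). \<not> ?far H}"
  define small where "small = {D \<in> Pow (cube n). card D \<le> card (cube n) / 64}"
  define Sk where "Sk = {S. S \<subseteq> {..<n} \<and> card S = k}"
  define code where "code = (\<lambda>(S, \<phi>, D). {x \<in> cube n. (ones_on S x \<in> \<phi>) \<noteq> (x \<in> D)})"
  have fin: "finite Sk" "finite small" by (auto simp: Sk_def small_def)
  have finS: "finite S" if "S \<in> Sk" for S using that finite_subset by (auto simp: Sk_def)
  have "near \<subseteq> code ` (SIGMA S:Sk. Pow (Pow S) \<times> small)"
  proof
    fix H assume "H \<in> near"
    then obtain g where H: "H \<subseteq> cube n" and "junta n k g"
      and d: "measure_pmf.prob (unif n) {x. (x \<in> H) \<noteq> g x} \<le> \<epsilon>"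
      by (auto simp: near_def far_from_juntas_def not_less)
    then obtain S \<phi> where S: "S \<in> Sk" and \<phi>: "\<phi> \<subseteq> Pow S"
      and g: "\<And>x. x \<in> cube n \<Longrightarrow> g x \<longleftrightarrow> ones_on S x \<in> \<phi>"
      unfolding junta_iff_ones_on Sk_def by blast
    let ?D = "cube n \<inter> {x. (x \<in> H) \<noteq> g x}"
    have "real (card ?D) / card (cube n) \<le> 1 / 64"
      using order_trans[OF d \<epsilon>] by (simp add: unif_def measure_pmf_of_set)
    then have "?D \<in> small"
      by (simp add: small_def card_cube field_simps)
    moreover have "H = code (S, \<phi>, ?D)"
      using H g by (auto simp: code_def)
    ultimately show "H \<in> code ` (SIGMA S:Sk. Pow (Pow S) \<times> small)" using S \<phi> by blast
  qed
  then have "card near \<le> card (SIGMA S:Sk. Pow (Pow S) \<times> small)"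
    using fin finS by (intro surj_card_le) (auto intro!: finite_SigmaI)
  also have "\<dots> = (\<Sum>S\<in>Sk. 2 ^ 2 ^ k * card small)"
  proof -
    have "card (Pow (Pow S) \<times> small) = 2 ^ 2 ^ k * card small" if "S \<in> Sk" for S
      using that finS[OF that] by (simp add: card_cartesian_product card_Pow Sk_def)
    moreover have "card (SIGMA S:Sk. Pow (Pow S) \<times> small) = (\<Sum>S\<in>Sk. card (Pow (Pow S) \<times> small))"
      using fin finS by (intro card_SigmaI) auto
    ultimately show ?thesis by simp
  qed
  also have "\<dots> = (n choose k) * (2 ^ 2 ^ k * card small)"
    using n_subsets[of "{..<n}" k] by (simp add: Sk_def)
  finally have "real (card near) \<le> real ((n choose k) * (2 ^ 2 ^ k * card small))"
    using of_nat_mono by blast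
  also have "\<dots> = real (n choose k) * (2 ^ 2 ^ k * real (card small))" by simp
  also have "\<dots> \<le> 2 powr (N / 4) * (2 powr (N / 8) * 2 powr (3 / 16 * N))"
  proof (intro mult_mono)
    have "4 * n \<le> 2 ^ n" using n(2) by (induction n rule: dec_induct) auto
    then have "real (4 * n) \<le> N" unfolding N_def by (metis of_nat_le_iff of_nat_numeral of_nat_power)
    have "real (n choose k) \<le> 2 ^ n"
      using binomial_le_pow2[of n k] by (metis of_nat_le_iff of_nat_numeral of_nat_power)
    also have "\<dots> = 2 powr n" by (simp add: powr_realpow)
    also have "\<dots> \<le> 2 powr (N / 4)" using \<open>real (4 * n) \<le> N\<close> by simp
    finally show "real (n choose k) \<le> 2 powr (N / 4)" .
    have "(2::real) ^ k * 2 ^ 3 \<le> 2 ^ n" unfolding power_add[symmetric] using n by (intro power_increasing) auto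
    then have "real (2 ^ k) \<le> N / 8" by (simp add: N_def)
    then have "2 powr real (2 ^ k) \<le> 2 powr (N / 8)" by (intro powr_mono) auto
    then show "(2::real) ^ 2 ^ k \<le> 2 powr (N / 8)" by (simp only: powr_realpow zero_less_numeral)
    show "real (card small) \<le> 2 powr (3 / 16 * N)"
      using small_subsets_card[of "cube n"] by (simp add: small_def card_cube N_def)
  qed auto
  also have "\<dots> = 2 powr (9 / 16 * N)" by (simp flip: powr_add)
  also have "\<dots> \<le> 2 powr (N - 2)"
  proof -
    have "(2::real) ^ 4 \<le> N" unfolding N_def using n by (intro power_increasing) auto
    then show ?thesis by simp
  qed
  also have "\<dots> = 2 ^ 2 ^ n / 4"
    using powr_realpow[of 2 "2 ^ n"] by (simp add: N_def powr_diff)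
  finally have "real (card near) \<le> 2 ^ 2 ^ n / 4" .
  moreover have "card near + card {H \<in> Pow (cube n). ?far H} = card (Pow (cube n))"
    unfolding near_def by (subst card_Un_disjoint[symmetric]) (auto intro!: arg_cong[of _ _ card])
  then have "real (card near) + real (card {H \<in> Pow (cube n). ?far H}) = 2 ^ 2 ^ n"
    unfolding of_nat_add[symmetric] by (simp add: card_Pow card_cube)
  ultimately show ?thesis by linarith
qed

subsection \<open>Overlap of two random juntas\<close>

text \<open>Hoeffding's lemma for a uniform sign, rescaled to a variable in {0, 2x} with weights
  1/2. Negative x follows by symmetry.\<close>

lemma cosh_le_exp_square: "(exp x + exp (- x)) / 2 \<le> exp (x\<^sup>2 / 2 :: real)"
proof -
  have *: "(exp x + exp (- x)) / 2 \<le> exp (x\<^sup>2 / 2 :: real)" if "x > 0" for x :: real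
  proof -
    have pos: "(1 + exp (2 * x)) / 2 > 0" by (smt (verit) exp_gt_zero half_gt_zero)
    have "- (2 * x) * (1 / 2) + ln (1 + (1 / 2) * (exp (2 * x) - 1)) \<le> (2 * x)\<^sup>2 / 8"
      using that by (intro Hoeffdings_lemma_aux) auto
    then have "ln ((1 + exp (2 * x)) / 2) \<le> x + x\<^sup>2 / 2"
      by (simp add: field_simps)
    then have "(1 + exp (2 * x)) / 2 \<le> exp (x + x\<^sup>2 / 2)"
      using pos by (metis exp_le_cancel_iff exp_ln)
    then have "exp (- x) * ((1 + exp (2 * x)) / 2) \<le> exp (- x) * exp (x + x\<^sup>2 / 2)"
      by (intro mult_left_mono) auto
    then show ?thesis by (simp add: field_simps flip: exp_add)
  qed
  show ?thesis
    using *[of x] *[of "- x"] by (cases x "0 :: real" rule: linorder_cases) (auto simp: add.commute)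
qed

text \<open>The cruder bound 1 + p \<le> exp p loses the term -p^2/2, which over the cube adds up to
  the saving from repeated sample points. This lemma and the next one together bound 1 + p s for
  both signs s with the same second-order and cubic terms.\<close>

lemma one_plus_le_exp_cubic:
  fixes p :: real
  assumes "0 \<le> p"
  shows "1 + p \<le> exp (p - p\<^sup>2 / 2 + p ^ 3)"
proof -
  let ?h = "\<lambda>p. p - p\<^sup>2 / 2 + p ^ 3 - ln (1 + p) :: real"
  have "?h 0 \<le> ?h p"
  proof (rule DERIV_nonneg_imp_nondecreasing[OF assms])
    fix x :: real assume x: "0 \<le> x" "x \<le> p"
    have "(?h has_real_derivative (1 - x + 3 * x\<^sup>2 - 1 / (1 + x))) (at x)"
      using x by (auto intro!: derivative_eq_intros simp: power2_eq_square)
    moreover have "1 - x + 3 * x\<^sup>2 - 1 / (1 + x) = (2 * x\<^sup>2 + 3 * x ^ 3) / (1 + x)"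
      using x by (simp add: field_simps power2_eq_square power3_eq_cube)
    moreover have "(2 * x\<^sup>2 + 3 * x ^ 3) / (1 + x) \<ge> 0" using x by simp
    ultimately show "\<exists>y. (?h has_real_derivative y) (at x) \<and> 0 \<le> y" by auto
  qed
  then have "ln (1 + p) \<le> p - p\<^sup>2 / 2 + p ^ 3" by simp
  then show ?thesis using assms by (metis add_nonneg_pos exp_le_cancel_iff exp_ln zero_less_one add.commute)
qed

lemma one_minus_le_exp_cubic:
  fixes p :: real
  assumes "0 \<le> p"
  shows "1 - p \<le> exp (- p - p\<^sup>2 / 2 + p ^ 3)"
proof (cases "p < 1")
  case True
  let ?h = "\<lambda>p. - p - p\<^sup>2 / 2 + p ^ 3 - ln (1 - p) :: real"
  have "?h 0 \<le> ?h p"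
  proof (rule DERIV_nonneg_imp_nondecreasing[OF assms])
    fix x :: real assume x: "0 \<le> x" "x \<le> p"
    have "(?h has_real_derivative (- 1 - x + 3 * x\<^sup>2 + 1 / (1 - x))) (at x)"
      using x True by (auto intro!: derivative_eq_intros simp: power2_eq_square)
    moreover have "- 1 - x + 3 * x\<^sup>2 + 1 / (1 - x) = x\<^sup>2 * (4 - 3 * x) / (1 - x)"
      using x True by (simp add: field_simps power2_eq_square power3_eq_cube)
    moreover have "x\<^sup>2 * (4 - 3 * x) / (1 - x) \<ge> 0" using x True by simp
    ultimately show "\<exists>y. (?h has_real_derivative y) (at x) \<and> 0 \<le> y" by auto
  qed
  then have "ln (1 - p) \<le> - p - p\<^sup>2 / 2 + p ^ 3" by simp
  then show ?thesis using True by (metis diff_gt_0_iff_gt exp_le_cancel_iff exp_ln)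
qed (smt (verit) exp_gt_zero)

text \<open>Averaging over the sign of one element \<open>i\<close> with \<open>w i = v\<close> replaces \<open>\<mu> v\<close> by
  \<open>\<mu> v + 2 (\<mu> v)\<^sup>2\<close> at the cost of a factor \<open>exp (\<mu> v)\<close>.\<close>

lemma sign_sum_square_mgf:
  fixes w :: "'a \<Rightarrow> 'b" and \<mu> :: "'b \<Rightarrow> real"
  assumes "finite I" "finite V" "w ` I \<subseteq> V" "\<And>v. v \<in> V \<Longrightarrow> 0 \<le> \<mu> v"
    and "\<And>v. v \<in> V \<Longrightarrow> 2 * \<mu> v * card {i \<in> I. w i = v} < 1"
  shows "(\<Sum>H\<in>Pow I. exp (\<Sum>v\<in>V. \<mu> v * (\<Sum>i\<in>{i \<in> I. w i = v}. sg (i \<in> H))\<^sup>2))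
    \<le> 2 ^ card I * (\<Prod>v\<in>V. 1 / sqrt (1 - 2 * \<mu> v * card {i \<in> I. w i = v}))"
  using assms(1,3-5)
proof (induction I arbitrary: \<mu> rule: finite_induct)
  case empty
  then show ?case by simp
next
  case (insert i I)
  define u where "u = w i"
  define J where "J v = {i \<in> I. w i = v}" for v
  define Y where "Y v H = (\<Sum>i\<in>J v. sg (i \<in> H))" for v H
  define l where "l = \<mu> u"
  define \<mu>' where "\<mu>' = \<mu>(u := l + 2 * l\<^sup>2)"
  let ?n = "real (card (J u))"
  have u: "u \<in> V" using insert.prems(1) by (simp add: u_def)
  have l0: "0 \<le> l" using insert.prems(2) u by (simp add: l_def)
  have finJ: "finite (J v)" for v using insert.hyps by (simp add: J_def)
  have iJ: "i \<notin> J v" for v using insert.hyps by (simp add: J_def)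
  have J': "{i' \<in> insert i I. w i' = v} = (if v = u then insert i (J u) else J v)" for v
    by (auto simp: J_def u_def)
  have ln: "2 * l * (?n + 1) < 1"
    using insert.prems(3)[OF u, unfolded J'] finJ iJ by (simp add: l_def add.commute)
  \<comment> \<open>The target 1 / sqrt (1 - 2 l n) is the moment of a Gaussian of variance n.
    Passing from \<open>l\<close> to \<open>l + 2 * l\<^sup>2\<close> while dropping one sign loses
    a factor 1 - 2 l under the root, which pays for the factor exp l since exp l \<le> 1 / sqrt (1 -
    2 l).\<close>
  have step: "1 - 2 * l * (?n + 1) \<le> (1 - 2 * l) * (1 - 2 * (l + 2 * l\<^sup>2) * ?n)"
  proof -
    have "(1 - 2 * l) * (1 - 2 * (l + 2 * l\<^sup>2) * ?n) = 1 - 2 * l * (?n + 1) + 8 * l ^ 3 * ?n"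
      by (simp add: algebra_simps power2_eq_square power3_eq_cube)
    then show ?thesis using l0 by simp
  qed
  have l1: "1 - 2 * l > 0" using ln l0 by (smt (verit) mult_left_mono of_nat_0_le_iff mult_cancel_left2)
  have pos': "1 - 2 * (l + 2 * l\<^sup>2) * ?n > 0"
    using step ln l1 by (smt (verit) zero_less_mult_pos)
  have IH: "(\<Sum>H\<in>Pow I. exp (\<Sum>v\<in>V. \<mu>' v * (Y v H)\<^sup>2))
      \<le> 2 ^ card I * (\<Prod>v\<in>V. 1 / sqrt (1 - 2 * \<mu>' v * card (J v)))"
    unfolding Y_def J_def
  proof (rule insert.IH)
    show "w ` I \<subseteq> V" using insert.prems by auto
    show "0 \<le> \<mu>' v" if "v \<in> V" for v using that insert.prems(2) l0 by (auto simp: \<mu>'_def)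
    show "2 * \<mu>' v * card {i \<in> I. w i = v} < 1" if "v \<in> V" for v
      using insert.prems(3)[OF that, unfolded J'] pos' by (cases "v = u") (simp_all add: \<mu>'_def flip: J_def)
  qed
  let ?Z = "\<lambda>H. exp (\<Sum>v\<in>V. \<mu> v * (\<Sum>i'\<in>{i' \<in> insert i I. w i' = v}. sg (i' \<in> H))\<^sup>2)"
  have split: "?Z H + ?Z (insert i H) \<le> 2 * exp l * exp (\<Sum>v\<in>V. \<mu>' v * (Y v H)\<^sup>2)" if "H \<in> Pow I" for H
  proof -
    have iH: "i \<notin> H" using that insert.hyps by auto
    let ?y = "Y u H" and ?E = "\<Sum>v\<in>V - {u}. \<mu> v * (Y v H)\<^sup>2"
    have S1: "(\<Sum>i'\<in>{i' \<in> insert i I. w i' = v}. sg (i' \<in> H)) = (if v = u then ?y - 1 else Y v H)" for v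
      unfolding J' using finJ iJ iH by (simp add: Y_def)
    have "(\<Sum>i'\<in>J v. sg (i' \<in> insert i H)) = Y v H" for v
      unfolding Y_def using iJ[of v] by (intro sum.cong refl) (auto simp: sg_def)
    then have S2: "(\<Sum>i'\<in>{i' \<in> insert i I. w i' = v}. sg (i' \<in> insert i H)) = (if v = u then ?y + 1 else Y v H)" for v
      unfolding J' using finJ iJ by simp
    have r: "(\<Sum>v\<in>V. f v) = f u + (\<Sum>v\<in>V - {u}. f v)" for f :: "'b \<Rightarrow> real"
      using assms(2) u by (rule sum.remove)
    have "?Z H + ?Z (insert i H) = exp (l * (?y - 1)\<^sup>2 + ?E) + exp (l * (?y + 1)\<^sup>2 + ?E)"
      unfolding S1 S2 r by (simp add: l_def)
    \<comment> \<open>In (y \<plusminus> 1)^2 = y^2 + 1 \<plusminus> 2y the constant gives exp l,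
      and the cross terms give a hyperbolic cosine, bounded by exp (2 l^2 y^2).\<close>
    also have "\<dots> = exp l * exp (l * ?y\<^sup>2 + ?E) * (2 * ((exp (2 * l * ?y) + exp (- (2 * l * ?y))) / 2))"
      by (simp add: power2_eq_square algebra_simps flip: exp_add)
    also have "\<dots> \<le> exp l * exp (l * ?y\<^sup>2 + ?E) * (2 * exp ((2 * l * ?y)\<^sup>2 / 2))"
      by (intro mult_left_mono cosh_le_exp_square) auto
    also have "\<dots> = 2 * exp l * exp ((l + 2 * l\<^sup>2) * ?y\<^sup>2 + ?E)"
      by (simp add: power2_eq_square algebra_simps flip: exp_add)
    also have "(l + 2 * l\<^sup>2) * ?y\<^sup>2 + ?E = (\<Sum>v\<in>V. \<mu>' v * (Y v H)\<^sup>2)"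
      unfolding r by (simp add: \<mu>'_def)
    finally show ?thesis .
  qed
  have "(\<Sum>H\<in>Pow (insert i I). ?Z H) = (\<Sum>H\<in>Pow I. ?Z H + ?Z (insert i H))"
    by (rule sum_Pow_insert[OF insert.hyps])
  also have "\<dots> \<le> (\<Sum>H\<in>Pow I. 2 * exp l * exp (\<Sum>v\<in>V. \<mu>' v * (Y v H)\<^sup>2))"
    by (intro sum_mono split)
  also have "\<dots> \<le> 2 * exp l * (2 ^ card I * (\<Prod>v\<in>V. 1 / sqrt (1 - 2 * \<mu>' v * card (J v))))"
    using IH by (simp flip: sum_distrib_left)
  also have "\<dots> = 2 ^ card (insert i I) * (exp l / sqrt (1 - 2 * (l + 2 * l\<^sup>2) * ?n) *
      (\<Prod>v\<in>V - {u}. 1 / sqrt (1 - 2 * \<mu> v * card (J v))))"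
    using insert.hyps by (simp add: prod.remove[OF assms(2) u] \<mu>'_def)
  also have "\<dots> \<le> 2 ^ card (insert i I) * (1 / sqrt (1 - 2 * l * (?n + 1)) *
      (\<Prod>v\<in>V - {u}. 1 / sqrt (1 - 2 * \<mu> v * card (J v))))"
  proof (intro mult_left_mono mult_right_mono prod_nonneg ballI)
    have "1 - 2 * l \<le> exp (- (2 * l))" using exp_ge_add_one_self[of "- (2 * l)"] by simp
    then have "1 - 2 * l * (?n + 1) \<le> exp (- (2 * l)) * (1 - 2 * (l + 2 * l\<^sup>2) * ?n)"
      using step pos' by (smt (verit) mult_right_mono)
    then have "sqrt (1 - 2 * l * (?n + 1)) \<le> sqrt (exp (- l) ^ 2 * (1 - 2 * (l + 2 * l\<^sup>2) * ?n))"
      by (intro real_sqrt_le_mono) (simp add: power2_eq_square flip: exp_add)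
    also have "\<dots> = exp (- l) * sqrt (1 - 2 * (l + 2 * l\<^sup>2) * ?n)"
      by (simp add: real_sqrt_mult)
    finally show "exp l / sqrt (1 - 2 * (l + 2 * l\<^sup>2) * ?n) \<le> 1 / sqrt (1 - 2 * l * (?n + 1))"
      using pos' ln by (simp add: field_simps exp_minus)
    fix v assume "v \<in> V - {u}"
    then show "0 \<le> 1 / sqrt (1 - 2 * \<mu> v * card (J v))"
      using insert.prems(3)[of v, unfolded J'] by simp
  qed simp
  also have "1 / sqrt (1 - 2 * l * (?n + 1)) * (\<Prod>v\<in>V - {u}. 1 / sqrt (1 - 2 * \<mu> v * card (J v))) =
      (\<Prod>v\<in>V. 1 / sqrt (1 - 2 * \<mu> v * card {i' \<in> insert i I. w i' = v}))"
    unfolding J' using finJ iJ by (simp add: prod.remove[OF assms(2) u] l_def add.commute)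
  finally show ?case .
qed

section \<open>Overlap for two fixed coordinate sets\<close>

lemma card_fixed_intersection:
  assumes "finite A" "w \<subseteq> A \<inter> B"
  shows "card {a \<in> Pow A. a \<inter> B = w} = 2 ^ card (A - B)"
proof -
  have "{a \<in> Pow A. a \<inter> B = w} = (\<lambda>r. w \<union> r) ` Pow (A - B)"
  proof (intro equalityI subsetI)
    fix a assume "a \<in> {a \<in> Pow A. a \<inter> B = w}"
    then have "a = w \<union> (a - B)" "a - B \<in> Pow (A - B)" by auto
    then show "a \<in> (\<lambda>r. w \<union> r) ` Pow (A - B)" by blast
  qed (use assms in auto)
  moreover have "inj_on (\<lambda>r. w \<union> r) (Pow (A - B))"
    using assms(2) by (auto intro!: inj_onI)
  ultimately show ?thesis using assms(1) by (simp add: card_image card_Pow)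
qed

text \<open>For fixed \<open>\<psi>\<close>, averaging over \<open>\<phi>\<close> gives hyperbolic
  cosines of \<open>p * G \<psi> a\<close>, where \<open>G \<psi> a\<close> adds the signs of
  \<open>\<psi>\<close> over the points with restriction \<open>a\<close> to \<open>S\<close>. Their
  exponential bound has a sum of squares of sign sums in the exponent, one for each subset of
  \<open>S \<inter> T\<close>, to which \<open>sign_sum_square_mgf\<close> applies with groups of
  2^j signs.\<close>

lemma random_junta_overlap:
  fixes p :: real
  assumes S: "S \<subseteq> {..<n}" "card S = k" and T: "T \<subseteq> {..<n}" "card T = k"
    and p: "0 \<le> p" "p \<le> 1" and x: "x = (p * 2 ^ (n - k))\<^sup>2" "x \<le> 1 / 2"
    and j: "j = card (S - T)"
  shows "(\<Sum>\<phi>\<in>Pow (Pow S). \<Sum>\<psi>\<in>Pow (Pow T).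
      \<Prod>Z\<in>Pow {..<n}. 1 + p * (sg (Z \<inter> S \<in> \<phi>) * sg (Z \<inter> T \<in> \<psi>)))
    \<le> 2 ^ 2 ^ k * 2 ^ 2 ^ k * exp (2 ^ n * (p ^ 3 - p\<^sup>2 / 2) + 2 ^ (k - j) * (x / 2 + x\<^sup>2))"
proof -
  have fin: "finite S" "finite T" using S T finite_subset by auto
  define r where "r = n - card (S \<union> T)"
  define Y where "Y \<psi> w = (\<Sum>c\<in>{c \<in> Pow T. c \<inter> S = w}. sg (c \<in> \<psi>))" for \<psi> w
  define G where "G \<psi> a = (\<Sum>Z\<in>{Z \<in> Pow {..<n}. Z \<inter> S = a}. sg (Z \<inter> T \<in> \<psi>))" for \<psi> a
  define E where "E = exp (2 ^ n * (p ^ 3 - p\<^sup>2 / 2))"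
  have E0: "0 \<le> E" by (simp add: E_def)
  \<comment> \<open>The coefficient of \<open>(Y \<psi> w)\<^sup>2\<close> in the exponent: each
    \<open>w\<close> is the trace on \<open>T\<close> of 2^j subsets of \<open>S\<close>, and the
    square of \<open>G\<close> carries a factor 4^r.\<close>
  define v where "v = p\<^sup>2 / 2 * 2 ^ j * 4 ^ r"
  have j': "card (T - S) = j" "card (S \<inter> T) = k - j" "j \<le> k"
    using S T fin j card_Diff_subset_Int[of S T] card_Diff_subset_Int[of T S]
      card_mono[of S "S \<inter> T"] by (auto simp: Int_commute)
  have "card (S \<union> T) = k + j"
    using card_Un_disjoint[of S "T - S"] fin S j' by simp
  moreover have "card (S \<union> T) \<le> n"
    using card_mono[of "{..<n}" "S \<union> T"] S T by simp
  ultimately have jr: "j + r = n - k" by (simp add: r_def)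
  have v: "2 * v * 2 ^ j = x"
  proof -
    have "2 * v * 2 ^ j = p\<^sup>2 * (2 ^ (j + r))\<^sup>2"
      by (simp add: v_def power_add power_mult_distrib power2_eq_square flip: power_mult_distrib)
    then show ?thesis by (simp add: jr x power_mult_distrib)
  qed
  \<comment> \<open>Prescribed restrictions to \<open>S\<close> and \<open>T\<close> are compatible
    only if they agree on \<open>S \<inter> T\<close>; then the \<open>r\<close> coordinates outside
    \<open>S \<union> T\<close> remain free.\<close>
  have G: "G \<psi> a = 2 ^ r * Y \<psi> (a \<inter> T)" if "a \<in> Pow S" for \<psi> a
  proof -
    have "G \<psi> a = (\<Sum>c\<in>Pow T. \<Sum>Z\<in>{Z \<in> {Z \<in> Pow {..<n}. Z \<inter> S = a}. Z \<inter> T = c}. sg (Z \<inter> T \<in> \<psi>))"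
      unfolding G_def using fin by (intro sum.group[symmetric]) auto
    also have "\<dots> = (\<Sum>c\<in>Pow T. if c \<inter> S = a \<inter> T then 2 ^ r * sg (c \<in> \<psi>) else 0)"
    proof (rule sum.cong[OF refl])
      fix c assume c: "c \<in> Pow T"
      have "card {Z \<in> {Z \<in> Pow {..<n}. Z \<inter> S = a}. Z \<inter> T = c} = (if c \<inter> S = a \<inter> T then 2 ^ r else 0)"
      proof (cases "c \<inter> S = a \<inter> T")
        case True
        have "{Z \<in> {Z \<in> Pow {..<n}. Z \<inter> S = a}. Z \<inter> T = c} = {Z \<in> Pow {..<n}. Z \<inter> (S \<union> T) = a \<union> c}"
          using True c that by blast
        moreover have "a \<union> c \<subseteq> {..<n} \<inter> (S \<union> T)" using c that S T by blast
        moreover have "card ({..<n} - (S \<union> T)) = r"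
          using S T fin by (subst card_Diff_subset) (auto simp: r_def)
        ultimately show ?thesis
          using card_fixed_intersection[of "{..<n}" "a \<union> c" "S \<union> T"] True by simp
      next
        case False
        then have "{Z \<in> {Z \<in> Pow {..<n}. Z \<inter> S = a}. Z \<inter> T = c} = {}" by blast
        then show ?thesis using False by simp
      qed
      then show "(\<Sum>Z\<in>{Z \<in> {Z \<in> Pow {..<n}. Z \<inter> S = a}. Z \<inter> T = c}. sg (Z \<inter> T \<in> \<psi>))
          = (if c \<inter> S = a \<inter> T then 2 ^ r * sg (c \<in> \<psi>) else 0)"
        by simp
    qed
    also have "\<dots> = 2 ^ r * Y \<psi> (a \<inter> T)"
      using fin by (simp add: Y_def sum.If_cases sum_distrib_left Int_def)
    finally show ?thesis .
  qed
  have G2: "p\<^sup>2 / 2 * (\<Sum>a\<in>Pow S. (G \<psi> a)\<^sup>2) = (\<Sum>w\<in>Pow (S \<inter> T). v * (Y \<psi> w)\<^sup>2)" for \<psi>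
  proof -
    have "(\<Sum>a\<in>Pow S. (G \<psi> a)\<^sup>2) = (\<Sum>a\<in>Pow S. 4 ^ r * (Y \<psi> (a \<inter> T))\<^sup>2)"
      by (intro sum.cong refl) (simp add: G power_mult_distrib power2_eq_square flip: power_mult_distrib)
    also have "\<dots> = (\<Sum>w\<in>Pow (S \<inter> T). \<Sum>a\<in>{a \<in> Pow S. a \<inter> T = w}. 4 ^ r * (Y \<psi> (a \<inter> T))\<^sup>2)"
      using fin by (intro sum.group[symmetric]) auto
    also have "\<dots> = (\<Sum>w\<in>Pow (S \<inter> T). 2 ^ j * (4 ^ r * (Y \<psi> w)\<^sup>2))"
    proof (rule sum.cong[OF refl])
      fix w assume "w \<in> Pow (S \<inter> T)"
      then have "card {a \<in> Pow S. a \<inter> T = w} = 2 ^ j"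
        using card_fixed_intersection[of S w T] fin by (simp add: j)
      then show "(\<Sum>a\<in>{a \<in> Pow S. a \<inter> T = w}. 4 ^ r * (Y \<psi> (a \<inter> T))\<^sup>2) = 2 ^ j * (4 ^ r * (Y \<psi> w)\<^sup>2)"
        by simp
    qed
    finally show ?thesis by (simp add: v_def sum_distrib_left mult_ac)
  qed
  have "(\<Sum>\<phi>\<in>Pow (Pow S). \<Prod>Z\<in>Pow {..<n}. 1 + p * (sg (Z \<inter> S \<in> \<phi>) * sg (Z \<inter> T \<in> \<psi>)))
      \<le> 2 ^ 2 ^ k * E * exp (\<Sum>w\<in>Pow (S \<inter> T). v * (Y \<psi> w)\<^sup>2)" for \<psi>
  proof -
    \<comment> \<open>The second-order and cubic terms are the same for either sign, so they come
      out as the constant \<open>E\<close> and only the linear term remains to be averaged.\<close>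
    have pt: "(\<Prod>Z\<in>Pow {..<n}. 1 + p * (sg (Z \<inter> S \<in> \<phi>) * sg (Z \<inter> T \<in> \<psi>)))
        \<le> E * (\<Prod>a\<in>Pow S. exp (p * G \<psi> a * sg (a \<in> \<phi>)))" for \<phi>
    proof -
      let ?s = "\<lambda>Z. sg (Z \<inter> S \<in> \<phi>) * sg (Z \<inter> T \<in> \<psi>)"
      have "(\<Prod>Z\<in>Pow {..<n}. 1 + p * ?s Z) \<le> (\<Prod>Z\<in>Pow {..<n}. exp ((p ^ 3 - p\<^sup>2 / 2) + p * ?s Z))"
      proof (rule prod_mono)
        fix Z
        show "0 \<le> 1 + p * ?s Z \<and> 1 + p * ?s Z \<le> exp ((p ^ 3 - p\<^sup>2 / 2) + p * ?s Z)"
          using p one_plus_le_exp_cubic[of p] one_minus_le_exp_cubic[of p]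
          by (auto simp: sg_def algebra_simps)
      qed
      also have "\<dots> = E * exp (\<Sum>Z\<in>Pow {..<n}. p * ?s Z)"
        unfolding exp_sum[OF finite_Pow_iff[THEN iffD2, OF finite_lessThan], symmetric]
        by (simp add: sum.distrib exp_add card_Pow E_def)
      also have "(\<Sum>Z\<in>Pow {..<n}. p * ?s Z) = (\<Sum>a\<in>Pow S. \<Sum>Z\<in>{Z \<in> Pow {..<n}. Z \<inter> S = a}. p * ?s Z)"
        using fin by (intro sum.group[symmetric]) auto
      also have "\<dots> = (\<Sum>a\<in>Pow S. p * G \<psi> a * sg (a \<in> \<phi>))"
        by (intro sum.cong refl) (simp add: G_def sum_distrib_left sum_distrib_right mult_ac)
      finally show ?thesis using fin by (simp add: exp_sum)
    qed
    have "(\<Sum>\<phi>\<in>Pow (Pow S). \<Prod>Z\<in>Pow {..<n}. 1 + p * (sg (Z \<inter> S \<in> \<phi>) * sg (Z \<inter> T \<in> \<psi>)))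
        \<le> E * (\<Sum>\<phi>\<in>Pow (Pow S). \<Prod>a\<in>Pow S. exp (p * G \<psi> a * sg (a \<in> \<phi>)))"
      unfolding sum_distrib_left by (intro sum_mono pt)
    also have "(\<Sum>\<phi>\<in>Pow (Pow S). \<Prod>a\<in>Pow S. exp (p * G \<psi> a * sg (a \<in> \<phi>)))
        = (\<Prod>a\<in>Pow S. exp (p * G \<psi> a) + exp (- (p * G \<psi> a)))"
      using sum_Pow_prod[of "Pow S" "\<lambda>a b. exp (p * G \<psi> a * sg b)"] fin by simp
    also have "\<dots> \<le> (\<Prod>a\<in>Pow S. 2 * exp ((p * G \<psi> a)\<^sup>2 / 2))"
      using cosh_le_exp_square[of "p * G \<psi> _"]
      by (intro prod_mono conjI add_nonneg_nonneg) (auto simp: field_simps)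
    also have "\<dots> = 2 ^ 2 ^ k * exp (p\<^sup>2 / 2 * (\<Sum>a\<in>Pow S. (G \<psi> a)\<^sup>2))"
      using fin S by (simp add: prod.distrib card_Pow power_mult_distrib sum_distrib_left exp_sum)
    finally show ?thesis unfolding G2 using E0 by (simp add: mult_right_mono mult_ac)
  qed
  then have "(\<Sum>\<psi>\<in>Pow (Pow T). \<Sum>\<phi>\<in>Pow (Pow S). \<Prod>Z\<in>Pow {..<n}. 1 + p * (sg (Z \<inter> S \<in> \<phi>) * sg (Z \<inter> T \<in> \<psi>)))
      \<le> 2 ^ 2 ^ k * E * (\<Sum>\<psi>\<in>Pow (Pow T). exp (\<Sum>w\<in>Pow (S \<inter> T). v * (Y \<psi> w)\<^sup>2))"
    unfolding sum_distrib_left by (intro sum_mono)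
  also have "\<dots> \<le> 2 ^ 2 ^ k * E * (2 ^ 2 ^ k * exp (2 ^ (k - j) * (x / 2 + x\<^sup>2)))"
  proof (rule mult_left_mono)
    have cv: "card {c \<in> Pow T. c \<inter> S = w} = 2 ^ j" if "w \<in> Pow (S \<inter> T)" for w
      using card_fixed_intersection[of T w S] fin that j' by (simp add: Int_commute)
    have "(\<Sum>\<psi>\<in>Pow (Pow T). exp (\<Sum>w\<in>Pow (S \<inter> T). v * (Y \<psi> w)\<^sup>2))
      \<le> 2 ^ card (Pow T) * (\<Prod>w\<in>Pow (S \<inter> T). 1 / sqrt (1 - 2 * v * card {c \<in> Pow T. c \<inter> S = w}))"
      unfolding Y_def
    proof (rule sign_sum_square_mgf)
      fix w assume w: "w \<in> Pow (S \<inter> T)"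
      show "0 \<le> v" by (simp add: v_def)
      show "2 * v * real (card {c \<in> Pow T. c \<inter> S = w}) < 1"
        unfolding cv[OF w] using v x(2) by simp
    qed (use fin in auto)
    also have "(\<Prod>w\<in>Pow (S \<inter> T). 1 / sqrt (1 - 2 * v * card {c \<in> Pow T. c \<inter> S = w}))
        = (\<Prod>w\<in>Pow (S \<inter> T). 1 / sqrt (1 - x))"
      by (intro prod.cong refl) (simp only: cv of_nat_power of_nat_numeral v)
    also have "\<dots> = (1 / sqrt (1 - x)) ^ 2 ^ (k - j)"
      using fin j' card_Pow[of "S \<inter> T"] by simp
    also have "\<dots> \<le> exp (x / 2 + x\<^sup>2) ^ 2 ^ (k - j)"
    proof (rule power_mono)
      have "0 \<le> x" using x by simp
      then have "- x - 2 * x\<^sup>2 \<le> ln (1 - x)" using x(2) by (intro ln_one_minus_pos_lower_bound)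
      moreover have "1 - x > 0" using x(2) by simp
      ultimately have "exp (- x - 2 * x\<^sup>2) \<le> 1 - x" by (metis exp_le_cancel_iff exp_ln)
      moreover have "exp (- x - 2 * x\<^sup>2) = (exp (- (x / 2 + x\<^sup>2)))\<^sup>2"
        by (simp add: power2_eq_square flip: exp_add)
      ultimately have "exp (- (x / 2 + x\<^sup>2)) \<le> sqrt (1 - x)"
        by (metis real_le_rsqrt)
      then have "1 / sqrt (1 - x) \<le> 1 / exp (- (x / 2 + x\<^sup>2))"
        by (intro divide_left_mono) (use x(2) in auto)
      then show "1 / sqrt (1 - x) \<le> exp (x / 2 + x\<^sup>2)" by (simp add: exp_minus field_simps)
    qed (use x(2) in simp)
    also have "\<dots> = exp (2 ^ (k - j) * (x / 2 + x\<^sup>2))"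
      by (simp add: exp_of_nat_mult[symmetric])
    finally show "(\<Sum>\<psi>\<in>Pow (Pow T). exp (\<Sum>w\<in>Pow (S \<inter> T). v * (Y \<psi> w)\<^sup>2))
        \<le> 2 ^ 2 ^ k * exp (2 ^ (k - j) * (x / 2 + x\<^sup>2))"
      using fin T by (simp add: card_Pow)
  qed (simp add: E_def)
  finally show ?thesis
    by (subst sum.swap) (simp add: E_def exp_add mult_ac)
qed

subsection \<open>Sample bounds for the two priors\<close>

lemma bij_betw_ones_on: "bij_betw (ones_on {..<n}) (cube n) (Pow {..<n})"
proof (rule bij_betw_imageI)
  show "inj_on (ones_on {..<n}) (cube n)"
  proof (rule inj_onI)
    fix x y assume xy: "x \<in> cube n" "y \<in> cube n" and eq: "ones_on {..<n} x = ones_on {..<n} y"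
    have "x ! i = y ! i" if "i < n" for i
    proof -
      have "i \<in> ones_on {..<n} x \<longleftrightarrow> i \<in> ones_on {..<n} y" using eq by simp
      then show ?thesis using that by (simp add: ones_on_def)
    qed
    then show "x = y" using xy by (intro nth_equalityI) (simp_all add: cube_def)
  qed
  show "ones_on {..<n} ` cube n = Pow {..<n}"
  proof (intro equalityI subsetI)
    fix Z assume "Z \<in> Pow {..<n}"
    then have "Z = ones_on {..<n} (map (\<lambda>i. i \<in> Z) [0..<n])" "map (\<lambda>i. i \<in> Z) [0..<n] \<in> cube n"
      by (auto simp: ones_on_def cube_def)
    then show "Z \<in> ones_on {..<n} ` cube n" by blast
  qed (auto simp: ones_on_def)
qed

text \<open>Identifying a point with its set of ones turns restrictions to coordinate sets into
  intersections.\<close>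

lemma prod_cube_ones_on:
  assumes "S \<subseteq> {..<n}" "T \<subseteq> {..<n}"
  shows "(\<Prod>z\<in>cube n. h (ones_on S z) (ones_on T z)) = (\<Prod>Z\<in>Pow {..<n}. h (Z \<inter> S) (Z \<inter> T))"
proof -
  have "ones_on S z = ones_on {..<n} z \<inter> S" "ones_on T z = ones_on {..<n} z \<inter> T" for z
    using assms by (auto simp: ones_on_def)
  then show ?thesis
    using prod.reindex_bij_betw[OF bij_betw_ones_on, of "\<lambda>Z. h (Z \<inter> S) (Z \<inter> T)"] by simp
qed

text \<open>The prior picks an index \<open>i\<close> uniformly and then a uniform family on
  \<open>S i\<close>. All \<open>S i\<close> have size \<open>k\<close>, so the number of families
  is the same for each index and cancels.\<close>

lemma random_junta_sample_bound:
  fixes S :: "'s \<Rightarrow> nat set" and x :: real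
  assumes tests: "tests_juntas A n k \<epsilon> m" and n: "k + 2 < n" "4 \<le> n" and \<epsilon>: "\<epsilon> \<le> 1 / 64"
    and I: "finite I" "I \<noteq> {}" and S: "\<And>i. i \<in> I \<Longrightarrow> S i \<subseteq> {..<n} \<and> card (S i) = k"
    and x: "x = (real m / 2 ^ k)\<^sup>2" "x \<le> 1 / 2"
  shows "5 / 4 * (real (card I))\<^sup>2 < (\<Sum>i\<in>I. \<Sum>j\<in>I.
    exp (2 ^ n * ((real m / 2 ^ n) ^ 3 - (real m / 2 ^ n)\<^sup>2 / 2) + 2 ^ (k - card (S i - S j)) * (x / 2 + x\<^sup>2)))"
    (is "_ < ?R")
proof -
  define p where "p = real m / 2 ^ n"
  define W where "W = (SIGMA i:I. Pow (Pow (S i)))"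
  define F where "F = (\<lambda>(i, \<phi>) z. ones_on (S i) z \<in> \<phi>)"
  have finS: "finite (S i)" if "i \<in> I" for i using S[OF that] finite_subset by blast
  have cW: "card W = card I * 2 ^ 2 ^ k"
  proof -
    have "card W = (\<Sum>i\<in>I. card (Pow (Pow (S i))))"
      unfolding W_def using I finS by (intro card_SigmaI) auto
    also have "\<dots> = (\<Sum>i\<in>I. 2 ^ 2 ^ k)"
      by (intro sum.cong refl) (simp add: card_Pow finS S)
    finally show ?thesis by simp
  qed
  have p1: "p \<le> 1"
  proof -
    have "(real m / 2 ^ k)\<^sup>2 \<le> 1\<^sup>2" using x by simp
    then have "real m / 2 ^ k \<le> 1" by (rule power2_le_imp_le) simp
    then have "real m \<le> 2 ^ k" by simp
    also have "(2::real) ^ k \<le> 2 ^ n" using n by (intro power_increasing) auto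
    finally show ?thesis by (simp add: p_def)
  qed
  have xp: "x = (p * 2 ^ (n - k))\<^sup>2"
    using n by (simp add: x p_def power_diff)
  have "5 / 4 * (real (card W))\<^sup>2 <
      (\<Sum>w\<in>W. \<Sum>w'\<in>W. \<Prod>z\<in>cube n. 1 + real m / 2 ^ n * (sg (F w z) * sg (F w' z)))"
  proof (rule tests_juntas_overlap[OF tests])
    show "finite W" using I finS by (auto simp: W_def)
    show "W \<noteq> {}" using I by (auto simp: W_def)
    show "junta n k (F w)" if w_in: "w \<in> W" for w
    proof -
      obtain i \<phi> where w: "w = (i, \<phi>)" "i \<in> I" "\<phi> \<subseteq> Pow (S i)" using w_in by (auto simp: W_def)
      then have "\<forall>z\<in>cube n. F w z \<longleftrightarrow> ones_on (S i) z \<in> \<phi>" by (simp add: F_def)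
      then show ?thesis using w S[OF w(2)] unfolding junta_iff_ones_on by blast
    qed
    show "3 / 4 * 2 ^ 2 ^ n \<le> real (card {H \<in> Pow (cube n). far_from_juntas n k \<epsilon> (\<lambda>z. z \<in> H)})"
      by (rule most_functions_far[OF n \<epsilon>])
  qed
  also have "\<dots> = (\<Sum>i\<in>I. \<Sum>\<phi>\<in>Pow (Pow (S i)). \<Sum>j\<in>I. \<Sum>\<psi>\<in>Pow (Pow (S j)).
      \<Prod>z\<in>cube n. 1 + p * (sg (ones_on (S i) z \<in> \<phi>) * sg (ones_on (S j) z \<in> \<psi>)))"
  proof -
    have "(\<Sum>w\<in>W. h w) = (\<Sum>i\<in>I. \<Sum>\<phi>\<in>Pow (Pow (S i)). h (i, \<phi>))" for h :: "_ \<Rightarrow> real"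
      unfolding W_def using I finS by (subst sum.Sigma) auto
    then show ?thesis by (simp add: F_def p_def)
  qed
  also have "\<dots> = (\<Sum>i\<in>I. \<Sum>j\<in>I. \<Sum>\<phi>\<in>Pow (Pow (S i)). \<Sum>\<psi>\<in>Pow (Pow (S j)).
      \<Prod>z\<in>cube n. 1 + p * (sg (ones_on (S i) z \<in> \<phi>) * sg (ones_on (S j) z \<in> \<psi>)))"
    by (intro sum.cong refl sum.swap)
  also have "\<dots> \<le> (\<Sum>i\<in>I. \<Sum>j\<in>I. 2 ^ 2 ^ k * 2 ^ 2 ^ k *
      exp (2 ^ n * (p ^ 3 - p\<^sup>2 / 2) + 2 ^ (k - card (S i - S j)) * (x / 2 + x\<^sup>2)))"
  proof (intro sum_mono)
    fix i j assume ij: "i \<in> I" "j \<in> I"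
    show "(\<Sum>\<phi>\<in>Pow (Pow (S i)). \<Sum>\<psi>\<in>Pow (Pow (S j)).
        \<Prod>z\<in>cube n. 1 + p * (sg (ones_on (S i) z \<in> \<phi>) * sg (ones_on (S j) z \<in> \<psi>)))
      \<le> 2 ^ 2 ^ k * 2 ^ 2 ^ k *
      exp (2 ^ n * (p ^ 3 - p\<^sup>2 / 2) + 2 ^ (k - card (S i - S j)) * (x / 2 + x\<^sup>2))"
    proof -
      have ST: "S i \<subseteq> {..<n}" "S j \<subseteq> {..<n}" using S ij by auto
      have "(\<Prod>z\<in>cube n. 1 + p * (sg (ones_on (S i) z \<in> \<phi>) * sg (ones_on (S j) z \<in> \<psi>)))
          = (\<Prod>Z\<in>Pow {..<n}. 1 + p * (sg (Z \<inter> S i \<in> \<phi>) * sg (Z \<inter> S j \<in> \<psi>)))" for \<phi> \<psi>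
        by (rule prod_cube_ones_on[OF ST])
      then show ?thesis
        using random_junta_overlap[of "S i" n k "S j" p x] S ij p1 xp x(2) by (simp add: p_def)
    qed
  qed
  also have "\<dots> = 2 ^ 2 ^ k * 2 ^ 2 ^ k * ?R"
    by (simp add: sum_distrib_left p_def)
  finally show ?thesis by (simp add: cW power2_eq_square algebra_simps)
qed

section \<open>The parity prior\<close>

text \<open>Toggling a coordinate in exactly one of the two sets flips the sign of the product, so
  the terms cancel in pairs.\<close>

lemma parity_orthogonal:
  fixes n :: nat
  assumes "S \<noteq> T" "S \<subseteq> {..<n}" "T \<subseteq> {..<n}"
  shows "(\<Sum>Z\<in>Pow {..<n}. sg (even (card (Z \<inter> S))) * sg (even (card (Z \<inter> T)))) = 0"
proof -
  obtain i where i: "i < n" "i \<in> S \<longleftrightarrow> i \<notin> T" using assms by blast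
  let ?c = "\<lambda>Z. sg (even (card (Z \<inter> S))) * sg (even (card (Z \<inter> T)))"
  have "(\<Sum>Z\<in>Pow (insert i ({..<n} - {i})). ?c Z) = (\<Sum>Z\<in>Pow ({..<n} - {i}). ?c Z + ?c (insert i Z))"
    by (rule sum_Pow_insert) auto
  also have "\<dots> = 0"
  proof (rule sum.neutral, rule ballI)
    fix Z assume Z: "Z \<in> Pow ({..<n} - {i})"
    then have fin: "finite Z" using finite_subset by auto
    have flip: "sg (even (card (insert i Z \<inter> U))) = (if i \<in> U then -1 else 1) * sg (even (card (Z \<inter> U)))" for U
    proof (cases "i \<in> U")
      case True
      then have "insert i Z \<inter> U = insert i (Z \<inter> U)" by auto
      moreover have "i \<notin> Z \<inter> U" using Z by auto
      ultimately show ?thesis using True fin by (simp add: sg_def)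
    qed simp
    show "?c Z + ?c (insert i Z) = 0" unfolding flip using i(2) by auto
  qed
  finally show ?thesis using i(1) by (simp add: insert_absorb)
qed

text \<open>Equal parities contribute at most exp m and, by orthogonality, distinct ones at most 1.
  With K = \<open>n choose k\<close> this gives 5/4 K^2 < K^2 + K exp m. The bound on
  \<open>m\<close> keeps the factors 1 \<plusminus> m / 2^n nonnegative.\<close>

lemma parity_sample_bound:
  assumes tests: "tests_juntas A n k \<epsilon> m" and n: "k + 2 < n" "4 \<le> n" and \<epsilon>: "\<epsilon> \<le> 1 / 64"
    and m: "real m \<le> 2 ^ n"
  shows "real (n choose k) < 4 * exp (real m)"
proof -
  define p where "p = real m / 2 ^ n"
  define W where "W = {S. S \<subseteq> {..<n} \<and> card S = k}"
  define F where "F = (\<lambda>S z. even (card (ones_on S z)))"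
  have p: "0 \<le> p" "p \<le> 1" using m by (auto simp: p_def)
  have cW: "card W = (n choose k)" using n_subsets[of "{..<n}" k] by (simp add: W_def)
  have C: "real (n choose k) > 0" using n by (simp add: zero_less_binomial)
  have finW: "finite W" by (auto simp: W_def)
  have "5 / 4 * (real (card W))\<^sup>2 <
      (\<Sum>S\<in>W. \<Sum>T\<in>W. \<Prod>z\<in>cube n. 1 + real m / 2 ^ n * (sg (F S z) * sg (F T z)))"
  proof (rule tests_juntas_overlap[OF tests])
    show "W \<noteq> {}" using cW C by auto
    show "junta n k (F S)" if S: "S \<in> W" for S
    proof -
      have "\<forall>x\<in>cube n. F S x \<longleftrightarrow> ones_on S x \<in> {a \<in> Pow S. even (card a)}"
        by (auto simp: F_def ones_on_def)
      moreover have "{a \<in> Pow S. even (card a)} \<subseteq> Pow S" by blast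
      ultimately show ?thesis using S unfolding junta_iff_ones_on W_def by blast
    qed
    show "3 / 4 * 2 ^ 2 ^ n \<le> real (card {H \<in> Pow (cube n). far_from_juntas n k \<epsilon> (\<lambda>z. z \<in> H)})"
      by (rule most_functions_far[OF n \<epsilon>])
  qed (fact finW)
  also have "\<dots> \<le> (\<Sum>S\<in>W. \<Sum>T\<in>W. 1 + (if S = T then exp (real m) else 0))"
  proof (intro sum_mono)
    fix S T assume "S \<in> W" "T \<in> W"
    then have ST: "S \<subseteq> {..<n}" "T \<subseteq> {..<n}" by (auto simp: W_def)
    let ?c = "\<lambda>Z. sg (even (card (Z \<inter> S))) * sg (even (card (Z \<inter> T)))"
    have "(\<Prod>z\<in>cube n. 1 + real m / 2 ^ n * (sg (F S z) * sg (F T z))) = (\<Prod>Z\<in>Pow {..<n}. 1 + p * ?c Z)"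
      unfolding F_def p_def
      by (rule prod_cube_ones_on[OF ST, where h = "\<lambda>a b. 1 + real m / 2 ^ n * (sg (even (card a)) * sg (even (card b)))"])
    also have "\<dots> \<le> (\<Prod>Z\<in>Pow {..<n}. exp (p * ?c Z))"
    proof (intro prod_mono conjI)
      fix Z
      show "0 \<le> 1 + p * ?c Z" using p by (auto simp: sg_def)
      show "1 + p * ?c Z \<le> exp (p * ?c Z)" by (rule exp_ge_add_one_self)
    qed
    also have "\<dots> = exp (p * (\<Sum>Z\<in>Pow {..<n}. ?c Z))"
      by (simp add: exp_sum sum_distrib_left)
    also have "\<dots> \<le> 1 + (if S = T then exp (real m) else 0)"
    proof (cases "S = T")
      case True
      then show ?thesis by (simp add: card_Pow p_def)
    next
      case False
      then show ?thesis using parity_orthogonal[OF False ST] by simp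
    qed
    finally show "(\<Prod>z\<in>cube n. 1 + real m / 2 ^ n * (sg (F S z) * sg (F T z)))
        \<le> 1 + (if S = T then exp (real m) else 0)" .
  qed
  also have "\<dots> = (real (card W))\<^sup>2 + real (card W) * exp (real m)"
    using finW by (simp add: sum.distrib power2_eq_square algebra_simps)
  finally show ?thesis using C by (simp add: cW power2_eq_square)
qed

text \<open>Without samples the exponent for a one-element index set is 0, and 5/4 < 1 would
  follow.\<close>

lemma sample_size_positive:
  assumes tests: "tests_juntas A n k \<epsilon> m" and n: "k + 2 < n" "4 \<le> n" and \<epsilon>: "\<epsilon> \<le> 1 / 64"
  shows "1 \<le> m"
proof (rule ccontr)
  assume "\<not> 1 \<le> m"
  then have "m = 0" by simp
  then show False
    using random_junta_sample_bound[OF tests n \<epsilon>, of "{()}" "\<lambda>_. {..<k}" 0] n by auto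
qed

section \<open>Random sets built from blocks\<close>

text \<open>\<open>C \<sigma>\<close> takes the element at offset \<open>\<sigma> b\<close> from
  block \<open>b\<close>, plus a fixed padding interval of \<open>q - s\<close> elements behind the
  blocks. Two such sets differ exactly in the blocks where the choices differ.\<close>

lemma block_family:
  assumes "s \<le> q" "s * B + (q - s) \<le> n"
  obtains C :: "(nat \<Rightarrow> nat) \<Rightarrow> nat set"
  where "\<And>\<sigma>. \<sigma> \<in> {..<s} \<rightarrow>\<^sub>E {..<B} \<Longrightarrow> C \<sigma> \<subseteq> {..<n} \<and> card (C \<sigma>) = q"
    and "\<And>\<sigma> \<tau>. \<lbrakk>\<sigma> \<in> {..<s} \<rightarrow>\<^sub>E {..<B}; \<tau> \<in> {..<s} \<rightarrow>\<^sub>E {..<B}\<rbrakk> \<Longrightarrow>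
      card (C \<sigma> - C \<tau>) = s - card {b \<in> {..<s}. \<sigma> b = \<tau> b}"
proof
  define pt where "pt \<sigma> b = b * B + \<sigma> b" for \<sigma> :: "nat \<Rightarrow> nat" and b
  define D where "D = {s * B..<s * B + (q - s)}"
  define C where "C \<sigma> = pt \<sigma> ` {..<s} \<union> D" for \<sigma>
  have pt: "b = b' \<and> \<sigma> b = \<tau> b'"
    if "\<sigma> \<in> {..<s} \<rightarrow>\<^sub>E {..<B}" "\<tau> \<in> {..<s} \<rightarrow>\<^sub>E {..<B}" "b < s" "b' < s" "pt \<sigma> b = pt \<tau> b'" for \<sigma> \<tau> b b'
  proof -
    have "\<sigma> b < B" "\<tau> b' < B" using that by auto
    then have "pt \<sigma> b div B = b" "pt \<tau> b' div B = b'" "pt \<sigma> b mod B = \<sigma> b" "pt \<tau> b' mod B = \<tau> b'"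
      by (auto simp: pt_def)
    then show ?thesis using that(5) by metis
  qed
  have lt: "pt \<sigma> b < s * B" if "\<sigma> \<in> {..<s} \<rightarrow>\<^sub>E {..<B}" "b < s" for \<sigma> b
  proof -
    have "pt \<sigma> b < Suc b * B" using that by (auto simp: pt_def)
    also have "\<dots> \<le> s * B" using that by (intro mult_le_mono1) auto
    finally show ?thesis .
  qed
  have disj: "pt \<sigma> ` {..<s} \<inter> D = {}" if "\<sigma> \<in> {..<s} \<rightarrow>\<^sub>E {..<B}" for \<sigma>
    using lt[OF that] by (fastforce simp: D_def)
  have inj: "inj_on (pt \<sigma>) X" if "\<sigma> \<in> {..<s} \<rightarrow>\<^sub>E {..<B}" "X \<subseteq> {..<s}" for \<sigma> X
    using pt[OF that(1) that(1)] that(2) by (auto intro!: inj_onI)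
  show "C \<sigma> \<subseteq> {..<n} \<and> card (C \<sigma>) = q" if \<sigma>: "\<sigma> \<in> {..<s} \<rightarrow>\<^sub>E {..<B}" for \<sigma>
  proof
    show "C \<sigma> \<subseteq> {..<n}" using lt[OF \<sigma>] assms by (fastforce simp: C_def D_def)
    show "card (C \<sigma>) = q"
      unfolding C_def using disj[OF \<sigma>] assms(1) inj[OF \<sigma> order_refl]
      by (subst card_Un_disjoint) (auto simp: D_def card_image)
  qed
  show "card (C \<sigma> - C \<tau>) = s - card {b \<in> {..<s}. \<sigma> b = \<tau> b}"
    if \<sigma>: "\<sigma> \<in> {..<s} \<rightarrow>\<^sub>E {..<B}" and \<tau>: "\<tau> \<in> {..<s} \<rightarrow>\<^sub>E {..<B}" for \<sigma> \<tau>
  proof -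
    have "C \<sigma> - C \<tau> = pt \<sigma> ` ({..<s} - {b \<in> {..<s}. \<sigma> b = \<tau> b})"
    proof (intro equalityI subsetI)
      fix y assume "y \<in> C \<sigma> - C \<tau>"
      then obtain b where b: "b < s" "y = pt \<sigma> b" "y \<notin> pt \<tau> ` {..<s}" by (auto simp: C_def)
      then have "\<sigma> b \<noteq> \<tau> b" by (auto simp: pt_def)
      then show "y \<in> pt \<sigma> ` ({..<s} - {b \<in> {..<s}. \<sigma> b = \<tau> b})" using b by auto
    next
      fix y assume "y \<in> pt \<sigma> ` ({..<s} - {b \<in> {..<s}. \<sigma> b = \<tau> b})"
      then obtain b where b: "b < s" "y = pt \<sigma> b" "\<sigma> b \<noteq> \<tau> b" by auto
      then have "y \<notin> pt \<tau> ` {..<s}" using pt[OF \<sigma> \<tau>] by fastforce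
      moreover have "y \<notin> D" using disj[OF \<sigma>] b by blast
      ultimately show "y \<in> C \<sigma> - C \<tau>" using b by (auto simp: C_def)
    qed
    then have "card (C \<sigma> - C \<tau>) = card ({..<s} - {b \<in> {..<s}. \<sigma> b = \<tau> b})"
      using card_image[OF inj[OF \<sigma>]] by auto
    also have "\<dots> = s - card {b \<in> {..<s}. \<sigma> b = \<tau> b}"
      by (subst card_Diff_subset) auto
    finally show ?thesis .
  qed
qed

text \<open>The sum factorises over blocks: one choice agrees with \<open>\<sigma>\<close> and has
  weight y, the other B - 1 choices have weight 1.\<close>

lemma sum_agreements:
  fixes y :: real
  assumes "\<sigma> \<in> {..<s} \<rightarrow>\<^sub>E {..<B}"
  shows "(\<Sum>\<tau>\<in>{..<s} \<rightarrow>\<^sub>E {..<B}. y ^ card {b \<in> {..<s}. \<sigma> b = \<tau> b}) = (y + real B - 1) ^ s"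
proof -
  have "(\<Sum>\<tau>\<in>{..<s} \<rightarrow>\<^sub>E {..<B}. y ^ card {b \<in> {..<s}. \<sigma> b = \<tau> b}) =
      (\<Sum>\<tau>\<in>{..<s} \<rightarrow>\<^sub>E {..<B}. \<Prod>b<s. if \<sigma> b = \<tau> b then y else 1)"
    by (simp add: prod.If_cases Int_def)
  also have "\<dots> = (\<Prod>b<s. \<Sum>v<B. if \<sigma> b = v then y else 1)"
    by (rule prod_sum_PiE[symmetric]) auto
  also have "\<dots> = (\<Prod>b<s. y + real B - 1)"
  proof (rule prod.cong[OF refl])
    fix b assume "b \<in> {..<s}"
    then have b: "\<sigma> b \<in> {..<B}" using assms by auto
    then have "(\<Sum>v<B. if \<sigma> b = v then y else 1) = y + (\<Sum>v\<in>{..<B} - {\<sigma> b}. if \<sigma> b = v then y else 1)"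
      by (subst sum.remove[of _ "\<sigma> b"]) auto
    also have "(\<Sum>v\<in>{..<B} - {\<sigma> b}. if \<sigma> b = v then y else 1) = (\<Sum>v\<in>{..<B} - {\<sigma> b}. 1)"
      by (intro sum.cong) auto
    also have "\<dots> = real B - 1" using b by (simp add: card_Diff_singleton of_nat_diff)
    finally show "(\<Sum>v<B. if \<sigma> b = v then y else 1) = y + real B - 1" by simp
  qed
  finally show ?thesis by simp
qed

subsection \<open>Numerical estimates\<close>

lemma log2_le_sqrt:
  fixes b :: real
  assumes "16 \<le> b"
  shows "log 2 b \<le> sqrt b"
proof -
  define r where "r = sqrt b"
  have r: "4 \<le> r" "b = r\<^sup>2" using assms by (auto simp: r_def real_le_rsqrt)
  have ln2: "1 / 2 \<le> ln (2::real)" using ln2_ge_two_thirds by simp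
  \<comment> \<open>The tangent of ln at 4, since log 2 b and sqrt b coincide at b = 16.\<close>
  have "ln (r / 4) \<le> r / 4 - 1" using r by (intro ln_le_minus_one) auto
  then have "ln r \<le> ln 4 + (r - 4) / 4" using r by (simp add: ln_div diff_divide_distrib)
  moreover have "ln (4::real) = 2 * ln 2" using ln_realpow[of 2 2] by simp
  moreover have "(r - 4) * (1 / 2) \<le> (r - 4) * ln 2" using r ln2 by (intro mult_left_mono) auto
  moreover have "(r - 4) * ln 2 = r * ln 2 - 4 * ln 2" by (simp add: algebra_simps)
  ultimately have "2 * ln r \<le> r * ln 2" by linarith
  moreover have "ln b = 2 * ln r" unfolding r(2) using r(1) by (simp add: ln_realpow)
  ultimately have "ln b \<le> r * ln 2" by simp
  then show ?thesis using ln2 unfolding r_def[symmetric] log_def by (simp add: pos_divide_le_eq)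
qed

text \<open>From s = 7 on, (1 + 1/s)^2 * 3/4 is at most 1, so the sequence no longer increases; the
  smaller values are evaluated.\<close>

lemma square_times_power_le: "(real s)\<^sup>2 * (3 / 4) ^ s \<le> 16"
proof (cases "s < 7")
  case True
  then have "s \<in> {0, 1, 2, 3, 4, 5, 6}" by auto
  then show ?thesis by (auto simp: power2_eq_square eval_nat_numeral)
next
  case False
  then have "7 \<le> s" by simp
  then show ?thesis
  proof (induction s rule: dec_induct)
    case base
    show ?case by (simp add: power2_eq_square eval_nat_numeral)
  next
    case (step s)
    have "7 * real s \<le> real s * real s" using step(1) by (intro mult_right_mono) auto
    moreover have "7 \<le> real s" using step(1) by simp
    moreover have "(real (Suc s))\<^sup>2 * (3 / 4) = 3 / 4 * (real s * real s) + 3 / 2 * real s + 3 / 4"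
      by (simp add: power2_eq_square algebra_simps)
    ultimately have "(real (Suc s))\<^sup>2 * (3 / 4) \<le> (real s)\<^sup>2"
      unfolding power2_eq_square by linarith
    then have "(real (Suc s))\<^sup>2 * (3 / 4) * (3 / 4) ^ s \<le> (real s)\<^sup>2 * (3 / 4) ^ s"
      by (rule mult_right_mono) simp
    also note step.IH
    finally show ?case by (simp add: mult.assoc)
  qed
qed

text \<open>Monotonicity of 2^i / i for i \<ge> 1. It turns a bound on \<mu> 2^s proportional to s
  into one on \<mu> 2^i proportional to i.\<close>

lemma times_power2_le:
  assumes "1 \<le> i" "i \<le> (s::nat)"
  shows "s * 2 ^ i \<le> i * 2 ^ s"
  using assms(2)
proof (induction s rule: dec_induct)
  case (step s)
  have "Suc s * 2 ^ i \<le> 2 * (s * 2 ^ i)" using step assms(1) by simp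
  also have "\<dots> \<le> 2 * (i * 2 ^ s)" using step.IH by (rule mult_le_mono2)
  finally show ?case by (simp add: mult_ac)
qed simp

lemma power_one_plus_le:
  fixes \<rho> :: real
  assumes "0 \<le> \<rho>"
  shows "(1 + \<rho>) ^ s \<le> 1 + s * \<rho> * (1 + \<rho>) ^ s"
proof (induction s)
  case (Suc s)
  have "1 \<le> (1 + \<rho>) ^ s" using assms by (intro one_le_power) auto
  then have "\<rho> * 1 \<le> \<rho> * ((1 + \<rho>) * (1 + \<rho>) ^ s)" using assms
    by (intro mult_left_mono) (auto simp: algebra_simps intro: add_increasing2)
  moreover have "(1 + \<rho>) * (1 + \<rho>) ^ s \<le> (1 + \<rho>) * (1 + s * \<rho> * (1 + \<rho>) ^ s)"
    using Suc assms by (intro mult_left_mono) auto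
  ultimately show ?case by (simp add: algebra_simps)
qed simp

text \<open>The doubly exponential moment is reduced to a generating function that can be summed
  exactly. Since u = \<mu> (2^i - 1) is at most i (ln B) / 2, the bound exp u \<le> 1 + u exp u is
  geometric in i with ratio y = 2 sqrt B. The relative excess after summation is of order (log B /
  sqrt B) s^2 (3/4)^s, where both factors are bounded.\<close>

lemma agreement_exp_moment:
  fixes \<mu> :: real and s B :: nat
  assumes B: "16 \<le> B" and \<mu>: "0 \<le> \<mu>" "\<mu> * 2 ^ s \<le> 16 / 10000 * s * log 2 (real B)"
  shows "(\<Sum>\<sigma>\<in>{..<s} \<rightarrow>\<^sub>E {..<B}. \<Sum>\<tau>\<in>{..<s} \<rightarrow>\<^sub>E {..<B}.
      exp (\<mu> * (2 ^ card {b \<in> {..<s}. \<sigma> b = \<tau> b} - 1))) \<le> 9 / 8 * (real B ^ s)\<^sup>2"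
proof -
  define y where "y = 2 * sqrt B"
  define \<rho> where "\<rho> = 2 / sqrt B"
  let ?E = "{..<s} \<rightarrow>\<^sub>E {..<B}"
  have sB: "4 \<le> sqrt B" using B by (simp add: real_le_rsqrt)
  have "\<rho> \<le> 2 / 4" unfolding \<rho>_def using sB B by (intro divide_left_mono) auto
  then have rho: "0 \<le> \<rho>" "\<rho> \<le> 1 / 2" by (auto simp: \<rho>_def)
  \<comment> \<open>Using y^i - 1 instead of y^i costs a factor 2, but pairs without agreement then
    contribute no excess; this matters because \<mu> need not be small.\<close>
  have pt: "exp (\<mu> * (2 ^ i - 1)) \<le> 1 + 2 * \<mu> * (y ^ i - 1)" if "i \<le> s" for i
  proof (cases "i = 0")
    case False
    define u where "u = \<mu> * (2 ^ i - 1)"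
    have u: "0 \<le> u" "u \<le> \<mu> * 2 ^ i" using \<mu> by (auto simp: u_def intro!: mult_left_mono)
    have lB: "0 \<le> log 2 (real B)" using B by simp
    have "u \<le> i * (ln B / 2)"
    proof -
      have "real (s * 2 ^ i) \<le> real (i * 2 ^ s)"
        using times_power2_le[of i s] False that by (simp only: of_nat_le_iff)
      then have "real s * 2 ^ i \<le> real i * 2 ^ s" by simp
      then have le: "(real s * 2 ^ i) * (16 / 10000 * log 2 B) \<le> (real i * 2 ^ s) * (16 / 10000 * log 2 B)"
        using lB by (intro mult_right_mono) auto
      have "(\<mu> * 2 ^ i) * 2 ^ s = \<mu> * 2 ^ s * 2 ^ i" by (simp only: mult_ac)
      also have "\<dots> \<le> 16 / 10000 * s * log 2 B * 2 ^ i"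
        using \<mu>(2) by (intro mult_right_mono) auto
      also have "\<dots> = (real s * 2 ^ i) * (16 / 10000 * log 2 B)" by (simp only: mult_ac)
      also note le
      also have "(real i * 2 ^ s) * (16 / 10000 * log 2 B) = (i * (16 / 10000 * log 2 B)) * 2 ^ s"
        by (simp only: mult_ac)
      finally have "(\<mu> * 2 ^ i) * 2 ^ s \<le> (i * (16 / 10000 * log 2 B)) * 2 ^ s" .
      then have "\<mu> * 2 ^ i \<le> i * (16 / 10000 * log 2 B)" by simp
      also have "\<dots> \<le> i * (ln B / 2)"
      proof (rule mult_left_mono)
        have "0 \<le> ln (real B)" using B by simp
        then have "16 / 10000 * ln B \<le> ln 2 / 2 * ln B"
          using ln2_ge_two_thirds by (intro mult_right_mono) auto
        then show "16 / 10000 * log 2 B \<le> ln B / 2"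
          by (simp add: log_def divide_le_eq mult_ac)
      qed simp
      finally show ?thesis using u by linarith
    qed
    then have "exp u \<le> exp (ln B / 2) ^ i" by (simp flip: exp_of_nat_mult)
    also have "exp (ln B / 2) = sqrt B" using B by (simp flip: ln_sqrt)
    finally have eu: "exp u \<le> sqrt B ^ i" .
    have "1 - u \<le> exp (- u)" using exp_ge_add_one_self[of "- u"] by simp
    then have "(1 - u) * exp u \<le> exp (- u) * exp u" by (intro mult_right_mono) auto
    then have "exp u \<le> 1 + u * exp u" by (simp add: algebra_simps flip: exp_add)
    also have "\<dots> \<le> 1 + (\<mu> * 2 ^ i) * sqrt B ^ i"
      using u eu \<mu> by (intro add_left_mono mult_mono) auto
    also have "\<dots> = 1 + \<mu> * y ^ i" by (simp add: y_def power_mult_distrib)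
    also have "\<dots> \<le> 1 + 2 * \<mu> * (y ^ i - 1)"
    proof -
      have y2: "2 \<le> y" using sB unfolding y_def by linarith
      have "1 \<le> y" "1 \<le> i" using y2 False by auto
      then have "y \<le> y ^ i" using self_le_power[of y i] by simp
      with y2 have "y ^ i \<le> 2 * (y ^ i - 1)" by simp
      then have "\<mu> * y ^ i \<le> \<mu> * (2 * (y ^ i - 1))" using \<mu>(1) by (rule mult_left_mono)
      then show ?thesis by (simp add: algebra_simps)
    qed
    finally show ?thesis by (simp add: u_def)
  qed simp
  have cE: "real (card ?E) = real B ^ s" by (simp add: card_PiE)
  have "(\<Sum>\<sigma>\<in>?E. \<Sum>\<tau>\<in>?E. exp (\<mu> * (2 ^ card {b \<in> {..<s}. \<sigma> b = \<tau> b} - 1)))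
      \<le> (\<Sum>\<sigma>\<in>?E. \<Sum>\<tau>\<in>?E. 1 + 2 * \<mu> * (y ^ card {b \<in> {..<s}. \<sigma> b = \<tau> b} - 1))"
  proof (intro sum_mono pt)
    fix \<sigma> \<tau> :: "nat \<Rightarrow> nat"
    have "card {b \<in> {..<s}. \<sigma> b = \<tau> b} \<le> card {..<s}" by (intro card_mono) auto
    then show "card {b \<in> {..<s}. \<sigma> b = \<tau> b} \<le> s" by simp
  qed
  also have "\<dots> = (\<Sum>\<sigma>\<in>?E. real B ^ s + 2 * \<mu> * ((y + real B - 1) ^ s - real B ^ s))"
  proof (rule sum.cong[OF refl])
    fix \<sigma> assume "\<sigma> \<in> ?E"
    then show "(\<Sum>\<tau>\<in>?E. 1 + 2 * \<mu> * (y ^ card {b \<in> {..<s}. \<sigma> b = \<tau> b} - 1)) =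
        real B ^ s + 2 * \<mu> * ((y + real B - 1) ^ s - real B ^ s)"
      using sum_agreements[of \<sigma> s B y] cE by (simp add: sum.distrib sum_subtractf flip: sum_distrib_left)
  qed
  also have "\<dots> = real B ^ s * (real B ^ s + 2 * \<mu> * ((y + real B - 1) ^ s - real B ^ s))"
    by (simp add: card_PiE)
  also have "\<dots> \<le> real B ^ s * (real B ^ s + real B ^ s / 8)"
  proof (intro mult_left_mono add_left_mono)
    have "\<rho> * B = y"
      using B by (simp add: \<rho>_def y_def field_simps)
    then have "(y + real B - 1) ^ s \<le> ((1 + \<rho>) * B) ^ s"
      using sB B unfolding y_def by (intro power_mono) (simp_all add: algebra_simps)
    then have "(y + real B - 1) ^ s - real B ^ s \<le> ((1 + \<rho>) ^ s - 1) * real B ^ s"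
      unfolding power_mult_distrib left_diff_distrib by simp
    also have "\<dots> \<le> (s * \<rho> * (3 / 2) ^ s) * real B ^ s"
    proof (rule mult_right_mono)
      have "s * \<rho> * (1 + \<rho>) ^ s \<le> s * \<rho> * (3 / 2) ^ s"
        using rho by (intro mult_left_mono power_mono) auto
      then show "(1 + \<rho>) ^ s - 1 \<le> s * \<rho> * (3 / 2) ^ s" using power_one_plus_le[OF rho(1), of s] by simp
    qed simp
    finally have "2 * \<mu> * ((y + real B - 1) ^ s - real B ^ s) \<le> 2 * \<mu> * ((s * \<rho> * (3 / 2) ^ s) * real B ^ s)"
      using \<mu>(1) by (intro mult_left_mono) auto
    also have "\<dots> = (\<mu> * 2 ^ s) * (2 * s * \<rho> * (3 / 4) ^ s) * real B ^ s"
    proof -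
      have "(3 / 2 :: real) ^ s = 2 ^ s * (3 / 4) ^ s" by (simp only: power_mult_distrib[symmetric]) simp
      then show ?thesis by simp
    qed
    also have "\<dots> \<le> (16 / 10000 * s * log 2 (real B)) * (2 * s * \<rho> * (3 / 4) ^ s) * real B ^ s"
      using rho by (intro mult_right_mono \<mu>(2)) auto
    also have "\<dots> = 64 / 10000 * (log 2 (real B) / sqrt B) * ((real s)\<^sup>2 * (3 / 4) ^ s) * real B ^ s"
      by (simp add: \<rho>_def power2_eq_square)
    also have "\<dots> \<le> 64 / 10000 * 1 * 16 * real B ^ s"
      using log2_le_sqrt[of B] B sB square_times_power_le[of s]
      by (intro mult_right_mono mult_mono) auto
    also have "\<dots> \<le> real B ^ s / 8" by simp
    finally show "2 * \<mu> * ((y + real B - 1) ^ s - real B ^ s) \<le> real B ^ s / 8" .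
  qed simp
  finally show ?thesis by (simp add: power2_eq_square)
qed

text \<open>Keep a single term of the expansion of (1 + z)^n at z = q / n, and bound the power by
  exp q.\<close>

lemma binomial_le_entropy:
  assumes "1 \<le> q" "q \<le> n"
  shows "real (n choose q) \<le> (exp 1 * (real n / real q)) ^ q"
proof -
  define z where "z = real q / real n"
  have z: "z > 0" using assms by (simp add: z_def)
  have "real (n choose q) * z ^ q \<le> (\<Sum>i\<le>n. real (n choose i) * z ^ i * 1 ^ (n - i))"
    using member_le_sum[of q "{..n}" "\<lambda>i. real (n choose i) * z ^ i"] assms z by simp
  also have "\<dots> = (z + 1) ^ n" by (rule binomial_ring[symmetric])
  also have "\<dots> \<le> exp z ^ n" using z exp_ge_add_one_self[of z] by (intro power_mono) (auto simp: add.commute)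
  also have "\<dots> = exp 1 ^ q" using assms by (simp add: z_def flip: exp_of_nat_mult)
  finally have "real (n choose q) \<le> exp 1 ^ q / z ^ q" using z by (simp add: field_simps)
  then show ?thesis by (simp add: z_def power_divide power_mult_distrib)
qed

lemma log_binomial_le_size:
  assumes "k \<le> n"
  shows "log 2 (real (n choose k)) \<le> real n"
proof -
  have "real (n choose k) \<le> real (2 ^ n)"
    using binomial_le_pow2[of n k] by (simp only: of_nat_le_iff)
  moreover have "0 < real (n choose k)" using assms by (simp add: zero_less_binomial)
  ultimately show ?thesis by (simp add: log_le_iff powr_realpow)
qed

text \<open>The cap \<open>n div 32\<close> on \<open>s\<close> forces B \<ge> 16. If s = q, the
  binomial coefficient is at most (e n / q)^q \<le> B^(2q). Otherwise s is comparable to n, and the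
  trivial bound n \<le> 64 s suffices because log 2 B \<ge> 4.\<close>

lemma log_binomial_le:
  fixes n q s B :: nat
  assumes n: "32 \<le> n" and q: "1 \<le> q" "2 * q \<le> n"
    and s: "s = min q (n div 32)" and B: "B = n div (2 * s)"
  shows "16 \<le> B" and "log 2 (real (n choose q)) \<le> 16 * s * log 2 (real B)"
proof -
  have s1: "1 \<le> s" "32 * s \<le> n" "s \<le> q" using n q by (auto simp: s)
  show B16: "16 \<le> B" using s1 by (simp add: B less_eq_div_iff_mult_less_eq)
  have C: "real (n choose q) > 0" using q by (simp add: zero_less_binomial)
  have lB: "4 \<le> log 2 (real B)"
    using log_le_cancel_iff[of 2 "2 ^ 4" "real B"] B16 by (simp only: log_pow_cancel) simp
  show "log 2 (real (n choose q)) \<le> 16 * s * log 2 (real B)"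
  proof (cases "s = q")
    case True
    have "n < 2 * s * (B + 1)" using s1 by (simp add: B dividend_less_times_div)
    then have "real n < real (2 * s * (B + 1))" by (simp only: of_nat_less_iff)
    then have "real n / real q \<le> 2 * (real B + 1)" using q True by (simp add: field_simps)
    also have "\<dots> \<le> 3 * real B" using B16 by simp
    finally have "exp 1 * (real n / real q) \<le> 3 * (3 * real B)" using exp_le by (intro mult_mono) auto
    also have "\<dots> \<le> (real B)\<^sup>2" using B16 by (simp add: power2_eq_square)
    finally have "(exp 1 * (real n / real q)) ^ q \<le> ((real B)\<^sup>2) ^ q" by (intro power_mono) auto
    then have "real (n choose q) \<le> real B ^ (2 * q)"
      unfolding power_mult using q by (intro order_trans[OF binomial_le_entropy]) auto
    then have "log 2 (real (n choose q)) \<le> log 2 (real B ^ (2 * q))" using C B16 by simp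
    also have "\<dots> = 2 * q * log 2 B" using B16 by (simp add: log_nat_power)
    also have "\<dots> \<le> 16 * s * log 2 B" using True lB by (intro mult_right_mono) auto
    finally show ?thesis .
  next
    case False
    then have "s = n div 32" by (auto simp: s)
    then have "n < 32 * (s + 1)" by (simp add: dividend_less_times_div)
    then have ns: "n \<le> 64 * s" using s1 by simp
    have "log 2 (real (n choose q)) \<le> real n" using q by (intro log_binomial_le_size) auto
    also have "real n \<le> real (64 * s)" using ns by (simp only: of_nat_le_iff)
    also have "\<dots> = real (16 * s) * 4" by simp
    also have "\<dots> \<le> 16 * s * log 2 B" using lB by (intro mult_left_mono) auto
    finally show ?thesis .
  qed
qed

lemma square_le_two_power:
  assumes "16 \<le> k"
  shows "real k ^ 2 \<le> 2 ^ k"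
  using assms
proof (induction k rule: dec_induct)
  case (step k)
  have "16 * real k \<le> real k * real k" using step by (intro mult_right_mono) auto
  moreover have "16 \<le> real k" using step by simp
  moreover have "real (Suc k) ^ 2 = real k * real k + 2 * real k + 1"
    by (simp add: power2_eq_square algebra_simps)
  ultimately have "real (Suc k) ^ 2 \<le> 2 * real k ^ 2"
    unfolding power2_eq_square by linarith
  then show ?case using step.IH by simp
qed simp

lemma cube_le_two_power:
  assumes "32 \<le> n"
  shows "real n ^ 3 \<le> 2 ^ n"
  using assms
proof (induction n rule: dec_induct)
  case (step n)
  have n: "32 \<le> real n" using step by simp
  have "32 * (real n * real n) \<le> real n * (real n * real n)" "32 * real n \<le> real n * real n"
    using n by (auto intro!: mult_right_mono)
  moreover have "real (Suc n) ^ 3 = real n * (real n * real n) + 3 * (real n * real n) + 3 * real n + 1"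
    by (simp add: power3_eq_cube algebra_simps)
  moreover have "real n ^ 3 = real n * (real n * real n)" by (simp add: power3_eq_cube)
  ultimately have "real (Suc n) ^ 3 \<le> 2 * real n ^ 3" using n by linarith
  then show ?case using step.IH by simp
qed simp

text \<open>The negative term \<open>- (real m)\<^sup>2 / (2 * 2 ^ n)\<close> comes from repeated sample points, on which
  both label distributions are consistent. It is needed only when \<open>s = n - k\<close>: then any two of
  the relevant sets are so close that their overlap is not negligible by itself.\<close>

lemma overlap_exponent_le:
  fixes n k m s i :: nat and L \<kappa> :: real
  assumes n: "32 \<le> n" "k + 2 < n" and s: "s = min (min k (n - k)) (n div 32)" "1 \<le> s" "i \<le> s"
    and \<kappa>: "0 \<le> \<kappa>" "\<kappa> \<le> 1 / 4" and L: "0 \<le> L" "L \<le> 2 ^ k" "L \<le> n"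
    and m: "(real m)\<^sup>2 \<le> \<kappa> * 2 ^ k * L"
    and x: "x = (real m / 2 ^ k)\<^sup>2"
  shows "2 ^ n * ((real m / 2 ^ n) ^ 3 - (real m / 2 ^ n)\<^sup>2 / 2) + 2 ^ (k - (s - i)) * (x / 2 + x\<^sup>2)
    \<le> 35 * \<kappa> + \<kappa> * L / 2 ^ s * (2 ^ i - 1)"
proof -
  define \<mu> where "\<mu> = (real m)\<^sup>2 / 2 ^ k"
  define t where "t = n - k"
  define e where "e = (2 ^ i / 2 ^ s :: real)"
  have sk: "s \<le> k" "s \<le> t" using s by (auto simp: t_def)
  have \<mu>: "0 \<le> \<mu>" "\<mu> \<le> \<kappa> * L" using m by (simp_all add: \<mu>_def field_simps)
  have e: "0 \<le> e" "e \<le> 1" using s by (auto simp: e_def intro!: power_increasing)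
  \<comment> \<open>Compared after squaring, to avoid fractional powers: m^6 is at most \<kappa>^3
    8^k L^3, and L^3 \<le> n^3 \<le> 2^n.\<close>
  have cubic: "(real m) ^ 3 / 4 ^ n \<le> \<kappa>"
  proof (rule power2_le_imp_le)
    have "real n ^ 3 \<le> 2 ^ n" using n(1) by (rule cube_le_two_power)
    then have L3: "L ^ 3 \<le> 2 ^ n" using power_mono[OF L(3,1), of 3] by linarith
    have "((real m) ^ 3)\<^sup>2 = ((real m)\<^sup>2) ^ 3" by (simp flip: power_mult)
    also have "\<dots> \<le> (\<kappa> * 2 ^ k * L) ^ 3" using m by (intro power_mono) auto
    also have "\<dots> = \<kappa> ^ 3 * (2 ^ k) ^ 3 * L ^ 3" by (simp add: power_mult_distrib)
    also have "\<dots> \<le> \<kappa>\<^sup>2 * (2 ^ n) ^ 3 * 2 ^ n"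
    proof (intro mult_mono L3)
      show "\<kappa> ^ 3 \<le> \<kappa>\<^sup>2" using \<kappa> by (intro power_decreasing) auto
      show "((2::real) ^ k) ^ 3 \<le> (2 ^ n) ^ 3" using n by (intro power_mono power_increasing) auto
    qed (use L \<kappa> in auto)
    also have "\<dots> = \<kappa>\<^sup>2 * (4 ^ n)\<^sup>2"
      by (simp add: power2_eq_square power3_eq_cube flip: power_mult_distrib)
    finally show "((real m) ^ 3 / 4 ^ n)\<^sup>2 \<le> \<kappa>\<^sup>2" by (simp add: power_divide divide_le_eq)
  qed (fact \<kappa>(1))
  have p: "2 ^ n * ((real m / 2 ^ n) ^ 3 - (real m / 2 ^ n)\<^sup>2 / 2) = real m ^ 3 / 4 ^ n - \<mu> / (2 * 2 ^ t)"
  proof -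
    have "(2::real) ^ n = 2 ^ k * 2 ^ t" using n by (simp add: t_def flip: power_add)
    moreover have "(4::real) ^ n = 2 ^ n * 2 ^ n" by (simp flip: power_mult_distrib)
    ultimately show ?thesis
      by (simp add: \<mu>_def power_divide power2_eq_square power3_eq_cube field_simps)
  qed
  have x': "x = \<mu> / 2 ^ k" by (simp add: x \<mu>_def power_divide power2_eq_square)
  have "(2::real) ^ (k - (s - i)) = 2 ^ k * e"
  proof -
    have "k - (s - i) + s = k + i" using s(3) sk by linarith
    then have "(2::real) ^ (k - (s - i)) * 2 ^ s = 2 ^ k * 2 ^ i" by (simp flip: power_add)
    then show ?thesis by (simp add: e_def field_simps)
  qed
  then have q: "2 ^ (k - (s - i)) * (x / 2 + x\<^sup>2) = e * (\<mu> / 2 + \<mu>\<^sup>2 / 2 ^ k)"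
    by (simp add: x' power_divide power2_eq_square field_simps)
  \<comment> \<open>The target has 2^i - 1 where the overlap has 2^i. If \<open>s = t\<close>, the
    term with 2^t supplies the missing -1 exactly; otherwise the difference is \<kappa> L / 2^s, and
    L / 2^s is at most 32.\<close>
  have "e * (\<mu> / 2 + \<mu>\<^sup>2 / 2 ^ k) - \<mu> / (2 * 2 ^ t) \<le> 34 * \<kappa> + \<kappa> * L / 2 ^ s * (2 ^ i - 1)"
  proof (cases "s = t")
    case True
    have "n \<le> 2 * k" "16 \<le> k" using n s True by (auto simp: t_def)
    have "real k ^ 2 \<le> 2 ^ k" using \<open>16 \<le> k\<close> by (rule square_le_two_power)
    have "\<mu>\<^sup>2 \<le> (\<kappa> * L)\<^sup>2" using \<mu> by (intro power_mono) auto
    also have "\<dots> \<le> (\<kappa> * (2 * k))\<^sup>2"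
      using L \<kappa> \<open>n \<le> 2 * k\<close> by (intro power_mono mult_left_mono) auto
    also have "\<dots> = 4 * \<kappa>\<^sup>2 * real k ^ 2" by (simp add: power_mult_distrib)
    also have "\<dots> \<le> 4 * (\<kappa> * 1) * 2 ^ k"
      using \<kappa> \<open>real k ^ 2 \<le> 2 ^ k\<close> unfolding power2_eq_square[of \<kappa>] by (intro mult_mono) auto
    finally have "\<mu>\<^sup>2 / 2 ^ k \<le> 4 * \<kappa>" by (simp add: divide_le_eq)
    then have "e * (\<mu>\<^sup>2 / 2 ^ k) \<le> 1 * (4 * \<kappa>)" using e by (intro mult_mono) auto
    moreover have "e * (\<mu> / 2) - \<mu> / (2 * 2 ^ t) = \<mu> / 2 * ((2 ^ i - 1) / 2 ^ s)"
      using True by (simp add: e_def field_simps)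
    moreover have "\<mu> / 2 * ((2 ^ i - 1) / 2 ^ s) \<le> \<kappa> * L * ((2 ^ i - 1) / 2 ^ s)"
      using \<mu> by (intro mult_right_mono) auto
    ultimately show ?thesis using \<kappa> by (simp add: distrib_left)
  next
    case False
    have L2: "L / 2 ^ s \<le> 32"
    proof (cases "s = k")
      case True
      then have "L \<le> 32 * 2 ^ s" using L by (smt (verit) zero_le_power)
      then show ?thesis by (simp add: divide_le_eq)
    next
      case False
      then have "s = n div 32" using \<open>s \<noteq> t\<close> s by (auto simp: t_def min_def split: if_splits)
      then have "n < 32 * (s + 1)" by (simp add: dividend_less_times_div)
      moreover obtain r where "s = Suc r" using s(2) by (cases s) auto
      ultimately have "n \<le> 64 * s" by simp
      then have "real n \<le> real (64 * s)" by (simp only: of_nat_le_iff)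
      moreover have "real (2 * s) \<le> real (2 ^ s)"
        unfolding of_nat_le_iff using s(2) by (induction s rule: dec_induct) auto
      ultimately show ?thesis using L by (simp add: divide_le_eq)
    qed
    have "\<mu>\<^sup>2 / 2 ^ k \<le> \<mu> / 2"
    proof -
      have "\<mu> \<le> 1 / 4 * 2 ^ k" using \<mu> mult_mono[OF \<kappa>(2) L(2)] L by simp
      then have "\<mu> * \<mu> \<le> \<mu> * (1 / 4 * 2 ^ k)" using \<mu> by (intro mult_left_mono) auto
      moreover have "0 \<le> \<mu> * 2 ^ k" using \<mu> by simp
      ultimately show ?thesis by (simp add: power2_eq_square divide_le_eq)
    qed
    then have "\<mu> / 2 + \<mu>\<^sup>2 / 2 ^ k \<le> \<kappa> * L" using \<mu>(2) by linarith
    then have "e * (\<mu> / 2 + \<mu>\<^sup>2 / 2 ^ k) \<le> e * (\<kappa> * L)"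
      using e(1) by (rule mult_left_mono)
    also have "\<dots> = \<kappa> * (L / 2 ^ s) + \<kappa> * L / 2 ^ s * (2 ^ i - 1)"
      by (simp add: e_def field_simps)
    also have "\<kappa> * (L / 2 ^ s) \<le> \<kappa> * 32" using L2 \<kappa> by (intro mult_left_mono) auto
    finally have "e * (\<mu> / 2 + \<mu>\<^sup>2 / 2 ^ k) \<le> \<kappa> * 32 + \<kappa> * L / 2 ^ s * (2 ^ i - 1)" by simp
    moreover have "0 \<le> \<mu> / (2 * 2 ^ t)" using \<mu> by simp
    ultimately show ?thesis using \<kappa> by linarith
  qed
  then show ?thesis unfolding p q using cubic by linarith
qed

section \<open>Assembling the lower bound\<close>

text \<open>By contradiction, with \<kappa> = 1/10000. The error 35 \<kappa> costs a factor of at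
  most 10/9 and the normalised agreement moment is at most 9/8; the product is exactly the threshold
  5/4.\<close>

lemma collision_sample_bound:
  assumes tests: "tests_juntas A n k \<epsilon> m" and k: "1 \<le> k" "k + 2 < n" and n: "32 \<le> n"
    and \<epsilon>: "\<epsilon> \<le> 1 / 64" and L: "L = log 2 (real (n choose k))" "L \<le> 2 ^ k"
  shows "1 / 10000 * 2 ^ k * L < (real m)\<^sup>2"
proof (rule ccontr)
  assume "\<not> ?thesis"
  then have m: "(real m)\<^sup>2 \<le> 1 / 10000 * 2 ^ k * L" by simp
  define q where "q = min k (n - k)"
  define s where "s = min q (n div 32)"
  define B where "B = n div (2 * s)"
  define \<mu> where "\<mu> = 1 / 10000 * L / 2 ^ s"
  define x where "x = (real m / 2 ^ k)\<^sup>2"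
  let ?E = "{..<s} \<rightarrow>\<^sub>E {..<B}"
  let ?I = "\<lambda>\<sigma> \<tau>. card {b \<in> {..<s}. \<sigma> b = \<tau> b}"
  have q: "1 \<le> q" "2 * q \<le> n" using k by (auto simp: q_def)
  have "(n choose q) = (n choose k)"
    using binomial_symmetric[of k n] k by (auto simp: q_def min_def)
  then have B: "16 \<le> B" and LB: "L \<le> 16 * s * log 2 (real B)"
    using log_binomial_le[OF n q s_def B_def] L(1) by auto
  have C: "1 \<le> real (n choose k)" using k by (simp add: Suc_le_eq zero_less_binomial)
  have L0: "0 \<le> L" "L \<le> n" using C log_binomial_le_size[of k n] k by (auto simp: L)
  have s1: "1 \<le> s" using q n by (auto simp: s_def)
  have "2 * (s * B) \<le> n" using div_times_less_eq_dividend[of n "2 * s"] by (simp add: B_def mult_ac)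
  \<comment> \<open>The blocks take at most half of the coordinates, and so does
    \<open>q\<close>.\<close>
  then have room: "s * B + (q - s) \<le> n" using q by linarith
  have sq: "s \<le> q" by (simp add: s_def)
  obtain C where C: "\<And>\<sigma>. \<sigma> \<in> ?E \<Longrightarrow> C \<sigma> \<subseteq> {..<n} \<and> card (C \<sigma>) = q"
    and CD: "\<And>\<sigma> \<tau>. \<lbrakk>\<sigma> \<in> ?E; \<tau> \<in> ?E\<rbrakk> \<Longrightarrow> card (C \<sigma> - C \<tau>) = s - ?I \<sigma> \<tau>"
    using block_family[OF sq room] by blast
  \<comment> \<open>Passing to complements only exchanges \<sigma> and \<tau> in the difference of
    two sets, and the agreement count is symmetric. This covers k > n / 2 with sets of size q = n -
    k.\<close>
  define S where "S \<sigma> = (if q = k then C \<sigma> else {..<n} - C \<sigma>)" for \<sigma>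
  have S: "S \<sigma> \<subseteq> {..<n} \<and> card (S \<sigma>) = k" if "\<sigma> \<in> ?E" for \<sigma>
  proof (cases "q = k")
    case False
    then have "q = n - k" by (auto simp: q_def)
    then show ?thesis
      using C[OF that] False k finite_subset[of "C \<sigma>" "{..<n}"] by (auto simp: S_def card_Diff_subset)
  qed (use C[OF that] in \<open>simp add: S_def\<close>)
  have SD: "card (S \<sigma> - S \<tau>) = s - ?I \<sigma> \<tau>" if "\<sigma> \<in> ?E" "\<tau> \<in> ?E" for \<sigma> \<tau>
  proof (cases "q = k")
    case False
    have "({..<n} - C \<sigma>) - ({..<n} - C \<tau>) = C \<tau> - C \<sigma>" using C[OF that(2)] by blast
    then show ?thesis using CD[OF that(2,1)] False by (simp add: S_def eq_commute)
  qed (use CD[OF that] in \<open>simp add: S_def\<close>)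
  have x12: "x \<le> 1 / 2"
  proof -
    have "(real m)\<^sup>2 \<le> 1 / 10000 * 2 ^ k * 2 ^ k"
      using mult_left_mono[OF L(2), of "1 / 10000 * 2 ^ k"] m by (intro order_trans[OF m]) simp
    then have "x \<le> 1 / 10000" by (simp add: x_def power_divide power2_eq_square divide_le_eq)
    then show ?thesis by simp
  qed
  have E: "finite ?E" "?E \<noteq> {}" using B by (auto simp: PiE_eq_empty_iff finite_PiE lessThan_empty_iff)
  have cE: "real (card ?E) = real B ^ s" by (simp add: card_PiE)
  have "5 / 4 * (real B ^ s)\<^sup>2 < (\<Sum>\<sigma>\<in>?E. \<Sum>\<tau>\<in>?E.
      exp (2 ^ n * ((real m / 2 ^ n) ^ 3 - (real m / 2 ^ n)\<^sup>2 / 2) + 2 ^ (k - card (S \<sigma> - S \<tau>)) * (x / 2 + x\<^sup>2)))"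
    using random_junta_sample_bound[OF tests k(2) _ \<epsilon> E S x_def x12] n unfolding cE by simp
  also have "\<dots> \<le> (\<Sum>\<sigma>\<in>?E. \<Sum>\<tau>\<in>?E. 10 / 9 * exp (\<mu> * (2 ^ ?I \<sigma> \<tau> - 1)))"
  proof (intro sum_mono)
    fix \<sigma> \<tau> assume st: "\<sigma> \<in> ?E" "\<tau> \<in> ?E"
    have "?I \<sigma> \<tau> \<le> card {..<s}" by (intro card_mono) auto
    then have I: "?I \<sigma> \<tau> \<le> s" by simp
    have "exp (2 ^ n * ((real m / 2 ^ n) ^ 3 - (real m / 2 ^ n)\<^sup>2 / 2) + 2 ^ (k - card (S \<sigma> - S \<tau>)) * (x / 2 + x\<^sup>2))
        \<le> exp (35 * (1 / 10000) + \<mu> * (2 ^ ?I \<sigma> \<tau> - 1))"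
      unfolding SD[OF st] \<mu>_def exp_le_cancel_iff
      by (rule overlap_exponent_le[OF n k(2) _ s1 I _ _ L0(1) L(2) L0(2) m x_def])
        (simp_all add: s_def q_def)
    also have "\<dots> \<le> 10 / 9 * exp (\<mu> * (2 ^ ?I \<sigma> \<tau> - 1))"
    proof -
      have "1 - 35 / 10000 \<le> exp (- (35 / 10000 :: real))" using exp_ge_add_one_self[of "- (35 / 10000)"] by simp
      then have "exp (35 / 10000 :: real) \<le> 10 / 9" by (simp add: exp_minus field_simps)
      then show ?thesis by (simp add: exp_add)
    qed
    finally show "exp (2 ^ n * ((real m / 2 ^ n) ^ 3 - (real m / 2 ^ n)\<^sup>2 / 2) +
        2 ^ (k - card (S \<sigma> - S \<tau>)) * (x / 2 + x\<^sup>2)) \<le> 10 / 9 * exp (\<mu> * (2 ^ ?I \<sigma> \<tau> - 1))" .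
  qed
  also have "\<dots> = 10 / 9 * (\<Sum>\<sigma>\<in>?E. \<Sum>\<tau>\<in>?E. exp (\<mu> * (2 ^ ?I \<sigma> \<tau> - 1)))"
    by (simp add: sum_distrib_left)
  also have "\<dots> \<le> 10 / 9 * (9 / 8 * (real B ^ s)\<^sup>2)"
  proof (intro mult_left_mono agreement_exp_moment[OF B])
    show "0 \<le> \<mu>" using L0 by (simp add: \<mu>_def)
    show "\<mu> * 2 ^ s \<le> 16 / 10000 * s * log 2 (real B)" using LB by (simp add: \<mu>_def)
  qed simp
  finally show False by simp
qed

text \<open>Parities give \<open>L \<le> 5 * real m\<close>. The square root is at most L when L >
  2^k; for n < 32 and L \<le> 2^k it is at most 2^29 \<le> 10^9, so m \<ge> 1 suffices; otherwise
  the collision bound applies. For k = 0 both terms vanish. The constant 1/10^10 leaves room for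
  10^9 + 5.\<close>

lemma junta_testing_lower_bound:
  assumes tests: "tests_juntas A n k \<epsilon> m" and \<epsilon>: "\<epsilon> \<le> 1 / 64" and n: "k + 2 < n"
    and L_def: "L = log 2 (real (n choose k))"
  shows "1 / 10 ^ 10 * (sqrt (2 ^ k * L) + L) \<le> real m"
proof (cases "k = 0")
  case True
  then show ?thesis by (simp add: L_def)
next
  case False
  then have k: "1 \<le> k" and n4: "4 \<le> n" using n by auto
  have C: "1 \<le> real (n choose k)" using n by (simp add: Suc_le_eq zero_less_binomial)
  have L0: "0 \<le> L" "L \<le> n" using C log_binomial_le_size[of k n] n by (auto simp: L_def)
  have m1: "1 \<le> real m" using sample_size_positive[OF tests n n4 \<epsilon>] by simp
  have mL: "L \<le> 5 * real m"
  proof (cases "real m \<le> 2 ^ n")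
    case True
    then have "real (n choose k) < 4 * exp (real m)"
      using parity_sample_bound[OF tests n n4 \<epsilon>] by simp
    \<comment> \<open>The factor 4 is moved into the exponent, where m \<ge> 1 absorbs it.\<close>
    also have "\<dots> \<le> exp 2 * exp (real m)"
    proof (rule mult_right_mono)
      have "2 * 2 \<le> exp 1 * exp (1::real)"
        using exp_ge_add_one_self[of "1 :: real"] by (intro mult_mono) auto
      then show "4 \<le> exp (2::real)" by (simp flip: exp_add)
    qed simp
    also have "\<dots> \<le> exp (3 * real m)" using m1 by (simp flip: exp_add)
    finally have "ln (real (n choose k)) \<le> ln (exp (3 * real m))"
      using C n by (subst ln_le_cancel_iff) auto
    then have "L * ln 2 \<le> 3 * real m" by (simp add: L_def log_def)
    moreover have "L * (2 / 3) \<le> L * ln 2" using L0 ln2_ge_two_thirds by (intro mult_left_mono) auto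
    ultimately show ?thesis using m1 by linarith
  next
    case False
    have "L \<le> real n" by (rule L0)
    also have "real n \<le> 2 ^ n" using of_nat_less_two_power[of n] by (simp add: less_imp_le)
    finally show ?thesis using False m1 by linarith
  qed
  have "sqrt (2 ^ k * L) \<le> 10 ^ 9 * real m"
  proof (cases "L \<le> 2 ^ k")
    case False
    then have "sqrt (2 ^ k * L) \<le> sqrt (L * L)" using L0 by (intro real_sqrt_le_mono mult_right_mono) auto
    then show ?thesis using L0 mL m1 by simp
  next
    case True
    show ?thesis
    proof (cases "n < 32")
      case small: True
      have "sqrt (2 ^ k * L) \<le> sqrt (2 ^ k * 2 ^ k)" using True by (intro real_sqrt_le_mono mult_left_mono) auto
      also have "\<dots> = 2 ^ k" by simp
      also have "\<dots> \<le> (2::real) ^ 29" using small n by (intro power_increasing) auto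
      also have "\<dots> \<le> 10 ^ 9 * 1" by simp
      also have "\<dots> \<le> 10 ^ 9 * real m" using m1 by (intro mult_left_mono) auto
      finally show ?thesis .
    next
      case big: False
      then have "1 / 10000 * 2 ^ k * L < (real m)\<^sup>2"
        using collision_sample_bound[OF tests k n _ \<epsilon> L_def True] by simp
      then have "2 ^ k * L \<le> (100 * real m)\<^sup>2" by (simp add: power_mult_distrib)
      then have "sqrt (2 ^ k * L) \<le> 100 * real m" by (intro real_le_lsqrt) (use L0 in auto)
      then show ?thesis using m1 by simp
    qed
  qed
  then show ?thesis using mL m1 by simp
qed

theorem theorem1p8:
  shows "\<exists>\<epsilon>\<^sub>0 > (0::real). \<exists>c > (0::real). \<forall>\<epsilon>. 0 < \<epsilon> \<and> \<epsilon> \<le> \<epsilon>\<^sub>0 \<longrightarrow>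
    (\<forall>(n::nat) (k::nat). k + 2 < n \<longrightarrow>
      (\<forall>(m::nat) (A::tester). tests_juntas A n k \<epsilon> m \<longrightarrow>
        real m \<ge> c * (sqrt (2 ^ k * log 2 (real (n choose k))) + log 2 (real (n choose k)))))"
proof (rule exI[of _ "1 / 64"], rule conjI)
  show "\<exists>c > (0::real). \<forall>\<epsilon>. 0 < \<epsilon> \<and> \<epsilon> \<le> 1 / 64 \<longrightarrow>
    (\<forall>(n::nat) (k::nat). k + 2 < n \<longrightarrow>
      (\<forall>(m::nat) (A::tester). tests_juntas A n k \<epsilon> m \<longrightarrow>
        real m \<ge> c * (sqrt (2 ^ k * log 2 (real (n choose k))) + log 2 (real (n choose k)))))"
    using junta_testing_lower_bound[OF _ _ _ refl]
    by (intro exI[of _ "1 / 10 ^ 10"] conjI allI impI) (blast | simp)+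
qed simp

end
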